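(* Let $R$ be a commutative partially ordered ring with $1$ containing $\mathbb{Q}$, with $1/m\ge 0$ for all $m\in\mathbb N$ (positive), let $n\ge 3$, and let $\Phi$ be an arbitrary automorphism of the semigroup $G_n(R)$. Then there exist a matrix $M\in\Gamma_n(R)$, an automorphism $c\in \mathrm{Aut}(R_+)$ and a central homothety $\Omega$ of the semigroup $GE_n^+(R)$ such that on $GE_n^+(R)$ one has $\Phi=\Phi_M\circ\Phi^c\circ\Omega$, i.e. $\Phi(X)=\Phi_M(\Phi^c(\Omega(X)))$ for all $X\in GE_n^+(R)$.
   Context: Partially ordered ring: a ring $R$ with a partial order $\le$ such that (1) $x\le y$ implies $x+z\le y+z$ for all $x,y,z\in R$; (2) $0\le x$ and $0\le y$ imply $0\le xy$. Put $R_+=\{r\in R: 0\le r\}$, a semiring; $\mathrm{Aut}(R_+)$ is the group of bijections $R_+\to R_+$ that are additive and multiplicative. $G_n(R)$ is the multiplicative semigroup of all matrices in $GL_n(R)$ all of whose entries lie in $R_+$. $\Gamma_n(R)$ is the group of all invertible elements of the semigroup $G_n(R)$ (i.e. $A\in G_n(R)$ with $A^{-1}\in G_n(R)$). $D_n(R)$ is the group of all diagonal matrices belonging to $\Gamma_n(R)$. $\Sigma_n$ is the symmetric group on $\{1,\dots,n\}$; for $\sigma\in\Sigma_n$, $S_\sigma=(\delta_{i\sigma(j)})$ is its permutation matrix. For $x\in R_+$ and $i\neq j$, $B_{ij}(x)=I+xE_{ij}$, where $E_{ij}$ is the matrix unit. $\mathbf P$ is the subsemigroup of $G_n(R)$ generated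 by all $S_\sigma$ ($\sigma\in\Sigma_n$), all $B_{ij}(x)$ ($x\in R_+$, $i\ne j$) and all matrices of $D_n(R)$. Matrices $A,B\in G_n(R)$ are called $\mathcal P$-equivalent if there exist matrices $A_0,\dots,A_k\in G_n(R)$ with $A_0=A$, $A_k=B$, and matrices $P_i,\widetilde P_i,Q_i,\widetilde Q_i\in\mathbf P$ ($i=0,\dots,k-1$) such that $P_iA_i\widetilde P_i=Q_iA_{i+1}\widetilde Q_i$ for all $i=0,\dots,k-1$. $GE_n^+(R)$ is the subsemigroup of $G_n(R)$ generated by all matrices that are $\mathcal P$-equivalent to matrices from $\mathbf P$. For a semigroup $G$ with center $Z(G)$, a homomorphism $\lambda:G\to G$ is called central if $\lambda(G)\subset Z(G)$; a central homothety of $G$ is a map $\Omega:G\to G$ of the form $\Omega(X)=\lambda(X)\cdot X$ with $\lambda$ a central homomorphism of $G$. For $M\in\Gamma_n(R)$, $\Phi_M(X)=MXM^{-1}$ for $X\in G_n(R)$. For $y\in\mathrm{Aut}(R_+)$, $\Phi^y$ is the automorphism of $G_n(R)$ given entrywise by $\Phi^y((x_{ij}))=(y(x_{ij}))$. *)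

theory Defs
  imports "HOL-Analysis.Analysis"
begin

text \<open>
  A commutative partially ordered ring with unit is a type of sort
  \<open>{comm_ring_1, ordered_comm_ring}\<close>: the order is partial, and monotonicity of multiplication
  by nonnegative elements is, in an ordered additive group, the same as closure of the
  nonnegative elements under products. An \<open>n \<times> n\<close> matrix has type \<open>'a ^ 'n ^ 'n\<close> with
  \<open>n = CARD('n)\<close>, so rows and columns are indexed by the finite type \<open>'n\<close> instead of \<open>{1..n}\<close>.
\<close>

definition rat_embedding :: "(rat \<Rightarrow> 'a::comm_ring_1) \<Rightarrow> bool" where
  "rat_embedding q \<longleftrightarrow>
     inj q \<and> q 1 = 1 \<and> (\<forall>x y. q (x + y) = q x + q y) \<and> (\<forall>x y. q (x * y) = q x * q y)"

definition nonneg_part :: "'a::ordered_comm_ring set" where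
  "nonneg_part = {r. 0 \<le> r}"

text \<open>Elements of \<open>Aut(R\<^sub>+)\<close> are total functions on \<open>R\<close>, considered only on \<open>R\<^sub>+\<close>.\<close>

definition nonneg_aut :: "('a::ordered_comm_ring \<Rightarrow> 'a) \<Rightarrow> bool" where
  "nonneg_aut c \<longleftrightarrow> bij_betw c nonneg_part nonneg_part \<and>
     (\<forall>x\<in>nonneg_part. \<forall>y\<in>nonneg_part. c (x + y) = c x + c y) \<and>
     (\<forall>x\<in>nonneg_part. \<forall>y\<in>nonneg_part. c (x * y) = c x * c y)"


inductive_set semigroup_generated :: "('a::semiring_1 ^ 'n ^ 'n) set \<Rightarrow> ('a ^ 'n ^ 'n) set"
  for S :: "('a ^ 'n ^ 'n) set" where
  base: "A \<in> S \<Longrightarrow> A \<in> semigroup_generated S"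
| mult: "A \<in> semigroup_generated S \<Longrightarrow> B \<in> semigroup_generated S \<Longrightarrow>
           A ** B \<in> semigroup_generated S"

definition semigroup_hom ::
  "('a::semiring_1 ^ 'n ^ 'n) set \<Rightarrow> ('a ^ 'n ^ 'n) set \<Rightarrow> ('a ^ 'n ^ 'n \<Rightarrow> 'a ^ 'n ^ 'n) \<Rightarrow> bool" where
  "semigroup_hom G H f \<longleftrightarrow> f ` G \<subseteq> H \<and> (\<forall>X\<in>G. \<forall>Y\<in>G. f (X ** Y) = f X ** f Y)"

definition semigroup_aut ::
  "('a::semiring_1 ^ 'n ^ 'n) set \<Rightarrow> ('a ^ 'n ^ 'n \<Rightarrow> 'a ^ 'n ^ 'n) \<Rightarrow> bool" where
  "semigroup_aut G f \<longleftrightarrow> semigroup_hom G G f \<and> bij_betw f G G"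

definition semigroup_center :: "('a::semiring_1 ^ 'n ^ 'n) set \<Rightarrow> ('a ^ 'n ^ 'n) set" where
  "semigroup_center G = {Z \<in> G. \<forall>X\<in>G. Z ** X = X ** Z}"

definition central_hom ::
  "('a::semiring_1 ^ 'n ^ 'n) set \<Rightarrow> ('a ^ 'n ^ 'n \<Rightarrow> 'a ^ 'n ^ 'n) \<Rightarrow> bool" where
  "central_hom G l \<longleftrightarrow> semigroup_hom G G l \<and> l ` G \<subseteq> semigroup_center G"

definition central_homothety ::
  "('a::semiring_1 ^ 'n ^ 'n) set \<Rightarrow> ('a ^ 'n ^ 'n \<Rightarrow> 'a ^ 'n ^ 'n) \<Rightarrow> bool" where
  "central_homothety G \<Omega> \<longleftrightarrow> (\<exists>l. central_hom G l \<and> (\<forall>X\<in>G. \<Omega> X = l X ** X))"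


text \<open>
  \<open>nonneg_GL\<close>, \<open>nonneg_GL_units\<close>, \<open>diag_units\<close>, \<open>P_semigroup\<close> and \<open>GE_plus\<close> are
  \<open>G\<^sub>n(R)\<close>, \<open>\<Gamma>\<^sub>n(R)\<close>, \<open>D\<^sub>n(R)\<close>, \<open>\<^bold>P\<close> and \<open>GE\<^sub>n\<^sup>+(R)\<close>. The inverse of a member of \<open>G\<^sub>n(R)\<close> may have
  entries outside \<open>R\<^sub>+\<close>; that of a member of \<open>\<Gamma>\<^sub>n(R)\<close> may not.
\<close>

definition nonneg_GL :: "('a::{comm_ring_1, ordered_comm_ring} ^ 'n ^ 'n) set" where
  "nonneg_GL = {A. invertible A \<and> (\<forall>i j. A $ i $ j \<in> nonneg_part)}"

definition nonneg_GL_units :: "('a::{comm_ring_1, ordered_comm_ring} ^ 'n ^ 'n) set" where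
  "nonneg_GL_units = {A \<in> nonneg_GL. \<exists>B\<in>nonneg_GL. A ** B = mat 1 \<and> B ** A = mat 1}"

definition diag_units :: "('a::{comm_ring_1, ordered_comm_ring} ^ 'n ^ 'n) set" where
  "diag_units = {A \<in> nonneg_GL_units. \<forall>i j. i \<noteq> j \<longrightarrow> A $ i $ j = 0}"

definition perm_matrix :: "('n \<Rightarrow> 'n) \<Rightarrow> 'a::comm_ring_1 ^ 'n ^ 'n" where
  "perm_matrix \<sigma> = (\<chi> i j. if i = \<sigma> j then 1 else 0)"

definition matrix_unit :: "'n \<Rightarrow> 'n \<Rightarrow> 'a::comm_ring_1 ^ 'n ^ 'n" where
  "matrix_unit i j = (\<chi> k l. if k = i \<and> l = j then 1 else 0)"

definition elem_matrix :: "'n \<Rightarrow> 'n \<Rightarrow> 'a \<Rightarrow> 'a::comm_ring_1 ^ 'n ^ 'n" where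
  "elem_matrix i j x = mat 1 + (\<chi> k l. x * matrix_unit i j $ k $ l)"

definition P_semigroup :: "('a::{comm_ring_1, ordered_comm_ring} ^ 'n ^ 'n) set" where
  "P_semigroup = semigroup_generated
     ({perm_matrix \<sigma> | \<sigma>. \<sigma> permutes UNIV} \<union>
      {elem_matrix i j x | i j x. i \<noteq> j \<and> x \<in> nonneg_part} \<union>
      diag_units)"

definition P_equivalent ::
  "'a::{comm_ring_1, ordered_comm_ring} ^ 'n ^ 'n \<Rightarrow> 'a ^ 'n ^ 'n \<Rightarrow> bool" where
  "P_equivalent A B \<longleftrightarrow>
     (\<exists>(k::nat) C P P' Q Q'.
        C 0 = A \<and> C k = B \<and> (\<forall>i\<le>k. C i \<in> nonneg_GL) \<and>
        (\<forall>i<k. P i \<in> P_semigroup \<and> P' i \<in> P_semigroup \<and>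
               Q i \<in> P_semigroup \<and> Q' i \<in> P_semigroup \<and>
               P i ** C i ** P' i = Q i ** C (Suc i) ** Q' i))"

definition GE_plus :: "('a::{comm_ring_1, ordered_comm_ring} ^ 'n ^ 'n) set" where
  "GE_plus = semigroup_generated {A \<in> nonneg_GL. \<exists>B\<in>P_semigroup. P_equivalent A B}"

definition conj_map :: "'a::comm_ring_1 ^ 'n ^ 'n \<Rightarrow> 'a ^ 'n ^ 'n \<Rightarrow> 'a ^ 'n ^ 'n" where
  "conj_map M X = M ** X ** matrix_inv M"

definition entrywise :: "('a \<Rightarrow> 'a) \<Rightarrow> 'a ^ 'n ^ 'n \<Rightarrow> 'a ^ 'n ^ 'n" where
  "entrywise c X = (\<chi> i j. c (X $ i $ j))"

end

theory Submission
  imports Defs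
begin

text \<open>
  Positivity makes the semigroup rigid: a vanishing sum of nonnegative elements vanishes term by
  term. Two classes of matrices can therefore be recognised from the multiplication alone and are
  preserved by \<open>\<Phi>\<close>. The diagonal units are the units that commute with all their conjugates by units
  (\<open>diag_units_characterisation\<close>). The root elements are the matrices that commute with their conjugates
  by diagonal units and are conjugate to their square by a diagonal unit; they contain all \<open>I + xE\<^sub>i\<^sub>j\<close>
  and are products of such matrices (\<open>root_elements_induct\<close>).

  Hence \<open>\<Phi>(I + xE\<^sub>i\<^sub>j) = I + N\<^sub>i\<^sub>j(x)\<close> with \<open>N\<^sub>i\<^sub>j(x)\<close> nonnegative and of square zero. The key is that the
  \<open>N\<^sub>i\<^sub>j(1)\<close> are the off-diagonal part of a system of matrix units. The relation
  \<open>diag(1,2)(I + E\<^sub>1\<^sub>2)(I + E\<^sub>2\<^sub>1) = (I + E\<^sub>2\<^sub>1)(I + E\<^sub>1\<^sub>2)diag(2,1)\<close>, graded by conjugation with \<open>diag(2,1)\<close>,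
  gives \<open>N\<^sub>1\<^sub>2 N\<^sub>2\<^sub>1 N\<^sub>1\<^sub>2 = N\<^sub>1\<^sub>2\<close> and shows that \<open>N\<^sub>1\<^sub>2 N\<^sub>2\<^sub>1\<close> is diagonal (\<open>matrix_unit_pair\<close>). The commutator
  relation gives \<open>N\<^sub>i\<^sub>j N\<^sub>j\<^sub>k = N\<^sub>i\<^sub>k + N\<^sub>j\<^sub>k N\<^sub>i\<^sub>j\<close>, where positivity kills the last term
  (\<open>N_reverse_mult_0\<close>); this excludes the transposed system of matrix units, which an
  inverse-transpose automorphism would produce. The diagonal matrix units sum to \<open>I\<close> since \<open>\<Phi>\<close> is
  surjective (\<open>E_sum\<close>), and comparison of traces shows that they have rank one. So the system is
  conjugate to the standard one by some \<open>M \<in> \<Gamma>\<^sub>n(R)\<close> (\<open>conjugating_matrix\<close>).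

  After conjugation by \<open>M\<inverse>\<close> the automorphism fixes all \<open>I + E\<^sub>i\<^sub>j\<close>. It then maps \<open>I + xE\<^sub>i\<^sub>j\<close> to
  \<open>I + c(x)E\<^sub>i\<^sub>j\<close> with one automorphism \<open>c\<close> of \<open>R\<^sub>+\<close>. A unit permutes the root elements by conjugation,
  so its image is known up to a scalar (\<open>standard_units\<close>). Thus on the generators of \<open>\<^bold>P\<close> the
  automorphism is \<open>\<Phi>\<^sup>c\<close> up to a scalar, which is a unit of \<open>R\<^sub>+\<close>. The same follows on products, along
  \<open>\<P>\<close>-equivalences by cancellation, and so on \<open>GE\<^sub>n\<^sup>+(R)\<close>. These scalars form the central homothety.
\<close>

section \<open>Matrices with nonnegative entries\<close>

definition nonneg_mat :: "'a::{comm_ring_1, ordered_comm_ring} ^ 'n ^ 'm \<Rightarrow> bool" where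
  "nonneg_mat A \<longleftrightarrow> (\<forall>i j. 0 \<le> A $ i $ j)"

definition pos_unit :: "'a::{comm_ring_1, ordered_comm_ring} \<Rightarrow> bool" where
  "pos_unit u \<longleftrightarrow> 0 \<le> u \<and> (\<exists>v. 0 \<le> v \<and> u * v = 1)"

definition diag_matrix :: "('n \<Rightarrow> 'a::comm_ring_1) \<Rightarrow> 'a ^ 'n ^ 'n" where
  "diag_matrix f = (\<chi> i j. if i = j then f i else 0)"

definition single_entry :: "'n \<Rightarrow> 'n \<Rightarrow> 'a::comm_ring_1 \<Rightarrow> 'a ^ 'n ^ 'n" where
  "single_entry i j x = (\<chi> k l. if k = i \<and> l = j then x else 0)"

lemma nonneg_matD: "nonneg_mat A \<Longrightarrow> 0 \<le> A $ i $ j"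
  by (simp add: nonneg_mat_def)

lemma nonneg_mat_add: "nonneg_mat A \<Longrightarrow> nonneg_mat B \<Longrightarrow> nonneg_mat (A + B)"
  by (simp add: nonneg_mat_def)

lemma nonneg_mat_mult: "nonneg_mat A \<Longrightarrow> nonneg_mat B \<Longrightarrow> nonneg_mat (A ** B)"
  by (simp add: nonneg_mat_def matrix_matrix_mult_def sum_nonneg)

lemma nonneg_mat_sum: "(\<And>x. x \<in> S \<Longrightarrow> nonneg_mat (f x)) \<Longrightarrow> nonneg_mat (sum f S)"
  by (simp add: nonneg_mat_def sum_nonneg)

lemma nonneg_add_eq_0:
  fixes a b :: "'a::{comm_ring_1, ordered_comm_ring}"
  assumes "a + b = 0" "0 \<le> a" "0 \<le> b"
  shows "a = 0" "b = 0"
  using assms by (simp_all add: add_nonneg_eq_0_iff)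

lemma nonneg_mat_add_eq_0:
  assumes "A + B = 0" "nonneg_mat A" "nonneg_mat B"
  shows "A = 0" "B = 0"
proof -
  have sum0: "A $ i $ j + B $ i $ j = 0" for i j
    using arg_cong[OF assms(1), of "\<lambda>X. X $ i $ j"] by simp
  then show "A = 0" "B = 0"
    using nonneg_add_eq_0[OF sum0 nonneg_matD[OF assms(2)] nonneg_matD[OF assms(3)]]
    by (simp_all add: vec_eq_iff)
qed

lemma mult_component: "(A ** B) $ i $ k = (\<Sum>j\<in>UNIV. A $ i $ j * B $ j $ k)"
  by (simp add: matrix_matrix_mult_def)

text \<open>
  Rigidity comes from the order in this form: a vanishing sum of nonnegative elements vanishes term
  by term, so a vanishing entry of a product kills every path \<open>i \<rightarrow> j \<rightarrow> k\<close> contributing to it.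
\<close>

lemma nonneg_entry_0_terms:
  assumes "(A ** B) $ i $ k = 0" "nonneg_mat A" "nonneg_mat B"
  shows "A $ i $ j * B $ j $ k = 0"
proof -
  have "(\<Sum>j\<in>UNIV. A $ i $ j * B $ j $ k) = 0"
    using assms(1) by (simp add: mult_component)
  moreover have "\<forall>j\<in>UNIV. 0 \<le> A $ i $ j * B $ j $ k"
    using assms(2,3) by (simp add: nonneg_mat_def)
  ultimately show ?thesis
    by (subst (asm) sum_nonneg_eq_0_iff) auto
qed

lemma nonneg_mult_0_terms:
  assumes "A ** B = 0" "nonneg_mat A" "nonneg_mat B"
  shows "A $ i $ j * B $ j $ k = 0"
  using nonneg_entry_0_terms assms by (metis zero_index)

lemma mult_0_from_terms:
  assumes "\<And>i j k. A $ i $ j * B $ j $ k = 0"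
  shows "A ** B = (0 :: 'a::comm_ring_1 ^ 'n ^ 'n)"
  using assms by (simp add: vec_eq_iff mult_component)

lemma mat_mult_diff_right: "(A::'a::comm_ring_1 ^ 'n ^ 'n) ** (B - C) = A ** B - A ** C"
  by (simp add: vec_eq_iff mult_component right_diff_distrib sum_subtractf)

lemma mat_mult_diff_left: "((A::'a::comm_ring_1 ^ 'n ^ 'n) - B) ** C = A ** C - B ** C"
  by (simp add: vec_eq_iff mult_component left_diff_distrib sum_subtractf)

lemma mat_mult_add_left: "((A::'a::comm_ring_1 ^ 'n ^ 'n) + B) ** C = A ** C + B ** C"
  by (simp add: vec_eq_iff mult_component distrib_right sum.distrib)

lemma mat_mult_0 [simp]:
  "(A::'a::comm_ring_1 ^ 'n ^ 'n) ** 0 = 0" "0 ** A = (0::'a ^ 'n ^ 'n)"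
  by (simp_all add: vec_eq_iff mult_component)

lemma mat_mult_sum_right:
  "(A::'a::comm_ring_1 ^ 'n ^ 'n) ** (\<Sum>x\<in>S. f x) = (\<Sum>x\<in>S. A ** f x)"
  by (induction S rule: infinite_finite_induct) (simp_all add: matrix_add_ldistrib)

lemma mat_mult_sum_left:
  "(\<Sum>x\<in>S. f x :: 'a ^ 'n ^ 'n) ** (A::'a::comm_ring_1 ^ 'n ^ 'n) = (\<Sum>x\<in>S. f x ** A)"
  by (induction S rule: infinite_finite_induct) (simp_all add: mat_mult_add_left)

lemmas mat_distribs = matrix_add_ldistrib mat_mult_add_left mat_mult_diff_right mat_mult_diff_left

lemma mat_cancel_left:
  assumes "A' ** A = mat 1" "A ** X = A ** (Y :: 'a::comm_ring_1 ^ 'n ^ 'n)"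
  shows "X = Y"
  by (metis assms matrix_mul_assoc matrix_mul_lid)

lemma mat_cancel_right:
  assumes "A ** A' = mat 1" "X ** A = Y ** (A :: 'a::comm_ring_1 ^ 'n ^ 'n)"
  shows "X = Y"
  by (metis assms matrix_mul_assoc matrix_mul_rid)

lemma inverse_mult:
  assumes "A ** A' = mat 1" "B ** B' = (mat 1 :: 'a::comm_ring_1 ^ 'n ^ 'n)"
  shows "(A ** B) ** (B' ** A') = mat 1"
  by (metis assms matrix_mul_assoc matrix_mul_rid)

lemma invertible_mult_comm_ring:
  assumes "invertible A" "invertible (B :: 'a::comm_ring_1 ^ 'n ^ 'n)"
  shows "invertible (A ** B)"
proof -
  obtain A' B' where
    "A ** A' = mat 1" "A' ** A = mat 1" "B ** B' = mat 1" "B' ** B = mat 1"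
    using assms by (auto simp: invertible_def)
  then show ?thesis
    unfolding invertible_def by (intro exI[of _ "B' ** A'"] conjI inverse_mult)
qed

lemma matrix_inv_eqI:
  assumes "A ** B = mat 1" "B ** A = (mat 1 :: 'a::comm_ring_1 ^ 'n ^ 'n)"
  shows "matrix_inv A = B"
proof -
  have "A ** matrix_inv A = mat 1 \<and> matrix_inv A ** A = mat 1"
    unfolding matrix_inv_def by (rule someI[of _ B]) (use assms in simp)
  then show ?thesis
    by (metis assms(2) matrix_mul_assoc matrix_mul_lid matrix_mul_rid)
qed

lemma diag_matrix_component: "diag_matrix f $ i $ j = (if i = j then f i else 0)"
  by (simp add: diag_matrix_def)

lemma diag_mult_component [simp]: "(diag_matrix f ** A) $ i $ j = f i * A $ i $ j"
  by (simp add: mult_component diag_matrix_component if_distrib[of "\<lambda>x. x * _"] cong: if_cong)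

lemma mult_diag_component [simp]: "(A ** diag_matrix f) $ i $ j = A $ i $ j * f j"
  by (simp add: mult_component diag_matrix_component if_distrib[of "\<lambda>x. _ * x"] cong: if_cong)

lemma diag_mult_diag: "diag_matrix f ** diag_matrix g = diag_matrix (\<lambda>i. f i * g i)"
  by (simp add: vec_eq_iff diag_matrix_component)

lemma diag_mult_commute: "diag_matrix f ** diag_matrix g = diag_matrix g ** diag_matrix f"
  by (simp add: diag_mult_diag mult.commute)

lemma mat_eq_diag: "mat x = diag_matrix (\<lambda>i. x)"
  by (simp add: vec_eq_iff mat_def diag_matrix_component)

lemma diag_matrix_1 [simp]: "diag_matrix (\<lambda>i. 1) = mat 1"
  by (simp add: mat_eq_diag)

lemma scalar_component: "(mat x ** (A :: 'a::comm_ring_1 ^ 'n ^ 'n)) $ i $ j = x * A $ i $ j"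
  by (simp add: mat_eq_diag)

lemma scalar_commute: "mat x ** A = A ** (mat x :: 'a::comm_ring_1 ^ 'n ^ 'n)"
  by (simp add: mat_eq_diag vec_eq_iff mult.commute)

lemma scalar_mult_scalar: "mat x ** mat y = (mat (x * y) :: 'a::comm_ring_1 ^ 'n ^ 'n)"
  by (simp add: mat_eq_diag diag_mult_diag)

lemma nonneg_diag_iff: "nonneg_mat (diag_matrix f) \<longleftrightarrow> (\<forall>i. 0 \<le> f i)"
proof
  assume "nonneg_mat (diag_matrix f)"
  then show "\<forall>i. 0 \<le> f i"
    by (metis diag_matrix_component nonneg_matD)
qed (simp add: nonneg_mat_def diag_matrix_component)

lemma single_entry_0 [simp]: "single_entry i j 0 = 0"
  by (simp add: single_entry_def vec_eq_iff)

lemma single_entry_inject: "single_entry i j x = single_entry i j y \<longleftrightarrow> x = y"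
  by (auto simp: single_entry_def vec_eq_iff)

lemma single_entry_mult:
  "single_entry i j x ** single_entry k l y = (if j = k then single_entry i l (x * y) else 0)"
  by (auto simp: vec_eq_iff mult_component single_entry_def if_distrib[of "\<lambda>x. x * _"]
      if_distrib[of "\<lambda>x. _ * x"] cong: if_cong)

lemma single_entry_add: "single_entry i j (x + y) = single_entry i j x + single_entry i j y"
  by (simp add: vec_eq_iff single_entry_def)

lemma elem_matrix_eq: "elem_matrix i j x = mat 1 + single_entry i j x"
  by (auto simp: elem_matrix_def matrix_unit_def single_entry_def vec_eq_iff)

lemma nonneg_single_entry: "0 \<le> x \<Longrightarrow> nonneg_mat (single_entry i j x)"
  by (simp add: nonneg_mat_def single_entry_def)

lemma mult_single_entry_component:
  "(A ** single_entry k l x) $ i $ j = (if j = l then A $ i $ k * x else 0)"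
  by (simp add: mult_component single_entry_def if_distrib[of "\<lambda>x. _ * x"] cong: if_cong)

lemma single_entry_mult_component:
  "(single_entry k l x ** A) $ i $ j = (if i = k then x * A $ l $ j else 0)"
  by (simp add: mult_component single_entry_def if_distrib[of "\<lambda>x. x * _"] cong: if_cong)

lemma scalar_if_commutes_single_entries:
  fixes Z :: "'a::comm_ring_1 ^ 'n ^ 'n"
  assumes "\<And>i j. i \<noteq> j \<Longrightarrow> Z ** single_entry i j 1 = single_entry i j 1 ** Z"
    and "CARD('n) \<ge> 2"
  shows "\<exists>z. Z = mat z"
proof -
  have eq: "(if l = j then Z $ k $ i else 0) = (if k = i then Z $ j $ l else 0)"
    if "i \<noteq> j" for i j k l
    using arg_cong[OF assms(1)[OF that], of "\<lambda>X. X $ k $ l"]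
    by (simp only: mult_single_entry_component single_entry_mult_component mult_1 mult_1_right)
  have diag: "Z $ i $ i = Z $ j $ j" for i j
    using eq[of i j j i] by (cases "i = j") auto
  have off: "Z $ k $ i = 0" if "k \<noteq> i" for k i
    using eq[of i k k k] that by auto
  have "Z = mat (Z $ undefined $ undefined)"
    using diag off by (auto simp: vec_eq_iff mat_def)
  then show ?thesis
    by blast
qed

section \<open>Invertible nonnegative matrices and their units\<close>

lemma nonneg_GL_iff: "A \<in> nonneg_GL \<longleftrightarrow> invertible A \<and> nonneg_mat A"
  by (auto simp: nonneg_GL_def nonneg_mat_def nonneg_part_def)

lemma nonneg_GL_mult: "A \<in> nonneg_GL \<Longrightarrow> B \<in> nonneg_GL \<Longrightarrow> A ** B \<in> nonneg_GL"
  by (simp add: nonneg_GL_iff nonneg_mat_mult invertible_mult_comm_ring)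

lemma units_iff:
  "A \<in> nonneg_GL_units \<longleftrightarrow>
     nonneg_mat A \<and> (\<exists>B. nonneg_mat B \<and> A ** B = mat 1 \<and> B ** A = mat 1)"
  by (auto simp: nonneg_GL_units_def nonneg_GL_iff invertible_def Bex_def)

lemma units_in_nonneg_GL: "A \<in> nonneg_GL_units \<Longrightarrow> A \<in> nonneg_GL"
  by (simp add: nonneg_GL_units_def)

lemma units_inverse_in_units:
  assumes "A \<in> nonneg_GL_units" "A ** B = mat 1"
  shows "B \<in> nonneg_GL_units" "B ** A = mat 1"
proof -
  obtain C where C: "nonneg_mat A" "nonneg_mat C" "A ** C = mat 1" "C ** A = mat 1"
    using assms(1) by (auto simp: units_iff)
  have "B = C"
    by (rule mat_cancel_left[OF C(4)]) (simp add: C assms)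
  then show "B \<in> nonneg_GL_units" "B ** A = mat 1"
    using C by (auto simp: units_iff)
qed

lemma units_mult:
  assumes "A \<in> nonneg_GL_units" "B \<in> nonneg_GL_units"
  shows "A ** B \<in> nonneg_GL_units"
proof -
  obtain A' B' where
    A': "nonneg_mat A" "nonneg_mat A'" "A ** A' = mat 1" "A' ** A = mat 1" and
    B': "nonneg_mat B" "nonneg_mat B'" "B ** B' = mat 1" "B' ** B = mat 1"
    using assms by (auto simp: units_iff)
  show ?thesis
    unfolding units_iff
    using A' B' by (intro conjI exI[of _ "B' ** A'"] nonneg_mat_mult inverse_mult)
qed

lemma diag_unitsD:
  assumes "d \<in> diag_units"
  shows "d = diag_matrix (\<lambda>i. d $ i $ i)" "pos_unit (d $ i $ i)"
proof -
  have off: "d $ i $ j = 0" if "i \<noteq> j" for i j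
    using assms that by (auto simp: diag_units_def)
  then show d: "d = diag_matrix (\<lambda>i. d $ i $ i)"
    by (auto simp: vec_eq_iff diag_matrix_component)
  obtain b where b: "nonneg_mat b" "d ** b = mat 1"
    using assms by (auto simp: diag_units_def units_iff)
  have "d $ i $ i * b $ i $ i = 1"
    using arg_cong[OF b(2), of "\<lambda>X. X $ i $ i"] by (subst (asm) d) (simp add: mat_def)
  moreover have "0 \<le> d $ i $ i"
    using assms by (auto simp: diag_units_def units_iff nonneg_mat_def)
  ultimately show "pos_unit (d $ i $ i)"
    unfolding pos_unit_def using b(1) nonneg_matD by blast
qed

lemma diag_units_iff: "d \<in> diag_units \<longleftrightarrow> (\<exists>f. d = diag_matrix f \<and> (\<forall>i. pos_unit (f i)))"
proof
  assume "d \<in> diag_units"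
  then show "\<exists>f. d = diag_matrix f \<and> (\<forall>i. pos_unit (f i))"
    using diag_unitsD by blast
next
  assume "\<exists>f. d = diag_matrix f \<and> (\<forall>i. pos_unit (f i))"
  then obtain f where f: "d = diag_matrix f" "\<And>i. pos_unit (f i)"
    by blast
  then obtain g where g: "\<And>i. 0 \<le> g i" "\<And>i. f i * g i = 1"
    unfolding pos_unit_def by metis
  have "nonneg_mat d" "nonneg_mat (diag_matrix g)" "d ** diag_matrix g = mat 1"
      "diag_matrix g ** d = mat 1"
    using f g by (simp_all add: nonneg_diag_iff pos_unit_def diag_mult_diag mult.commute)
  then show "d \<in> diag_units"
    by (auto simp: diag_units_def units_iff f(1) diag_matrix_component)
qed

text \<open>
  If \<open>B\<close> is the nonnegative inverse of a nonnegative \<open>A\<close>, the off-diagonal entries of \<open>AB = I\<close>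
  force \<open>a\<^sub>i\<^sub>k b\<^sub>k\<^sub>j = 0\<close> for \<open>i \<noteq> j\<close>: up to orthogonal idempotents, \<open>A\<close> is monomial.
\<close>

lemma unit_inverse_terms:
  assumes "nonneg_mat A" "nonneg_mat B" "A ** B = mat 1" "i \<noteq> j"
  shows "A $ i $ k * B $ k $ j = 0"
  using nonneg_entry_0_terms[of A B i j k] assms by (simp add: mat_def)

text \<open>
  Therefore \<open>hgh\<inverse>\<close> stays diagonal for diagonal \<open>g\<close>: the entries off the diagonal are sums of terms
  \<open>h\<^sub>i\<^sub>k g\<^sub>k h'\<^sub>k\<^sub>j\<close>.
\<close>

lemma diag_units_conj:
  fixes h :: "'a::{comm_ring_1, ordered_comm_ring} ^ 'n ^ 'n"
  assumes "nonneg_mat h" "nonneg_mat h'" "h ** h' = mat 1" "h' ** h = mat 1" "g \<in> diag_units"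
  shows "h ** g ** h' \<in> diag_units"
proof -
  obtain f where f: "g = diag_matrix f" "\<And>i. pos_unit (f i)"
    using assms(5) diag_units_iff by blast
  have "(h ** g ** h') $ i $ j = 0" if "i \<noteq> j" for i j
  proof -
    have "h $ i $ k * f k * h' $ k $ j = 0" for k
      using unit_inverse_terms[OF assms(1-3) that, of k] by (simp add: mult.commute mult.left_commute)
    then show ?thesis
      by (simp add: f mult_component[of "h ** diag_matrix f"])
  qed
  moreover have "h ** g ** h' \<in> nonneg_GL_units"
  proof -
    have "h \<in> nonneg_GL_units" "h' \<in> nonneg_GL_units" "g \<in> nonneg_GL_units"
      using assms units_iff by (auto simp: diag_units_def)
    then show ?thesis
      by (simp add: units_mult)
  qed
  ultimately show ?thesis
    by (simp add: diag_units_def)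
qed

section \<open>Diagonal units and root elements in terms of the multiplication\<close>

text \<open>
  The matrices \<open>I + xE\<^sub>i\<^sub>j\<close> have two properties that refer only to the multiplication and to the
  diagonal units: they commute with all their conjugates by diagonal units, and some such conjugate
  is their square. The first forces the shape \<open>\<Delta> + N\<close> with \<open>\<Delta>\<close> diagonal and \<open>N\<^sup>2 = 0\<close> path by path,
  the second then forces \<open>\<Delta> = I\<close>.
\<close>

definition root_elements :: "('a::{comm_ring_1, ordered_comm_ring} ^ 'n ^ 'n) set" where
  "root_elements = {X \<in> nonneg_GL.
     (\<forall>d\<in>diag_units. \<forall>d'\<in>diag_units. d ** d' = mat 1 \<longrightarrow>
        X ** (d ** X ** d') = (d ** X ** d') ** X) \<and>
     (\<exists>d\<in>diag_units. \<exists>d'\<in>diag_units. d ** d' = mat 1 \<and> d ** X ** d' = X ** X)}"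

definition scale_at :: "'n \<Rightarrow> 'a::comm_ring_1 \<Rightarrow> 'a ^ 'n ^ 'n" where
  "scale_at k t = diag_matrix (\<lambda>i. if i = k then t else 1)"

lemma conj_diag_left:
  "(X ** (diag_matrix f ** X ** diag_matrix g)) $ i $ k =
     (\<Sum>l\<in>UNIV. f l * g k * (X $ i $ l * X $ l $ k))"
  by (simp add: mult_component[of X] mult.commute mult.left_commute)

lemma conj_diag_right:
  "((diag_matrix f ** X ** diag_matrix g) ** X) $ i $ k =
     (\<Sum>l\<in>UNIV. f i * g l * (X $ i $ l * X $ l $ k))"
  by (simp add: mult_component[of "diag_matrix f ** X ** diag_matrix g"] mult.commute mult.left_commute)

text \<open>Positive rational scalars enter through the nonnegative inverses of the natural numbers.\<close>

locale nonneg_nat_inverses =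
  fixes ring_type :: "'a::{comm_ring_1, ordered_comm_ring} itself"
  assumes nat_inverse: "0 < m \<Longrightarrow> \<exists>r::'a. 0 \<le> r \<and> of_nat m * r = 1"
begin

lemma zero_le_1: "0 \<le> (1::'a)"
  using nat_inverse[of 1] by auto

lemma of_nat_mult_cancel:
  assumes "of_nat m * x = of_nat m * (y::'a)" "0 < m"
  shows "x = y"
proof -
  obtain r :: 'a where "of_nat m * r = 1"
    using nat_inverse assms(2) by blast
  then show ?thesis
    using assms(1) by (metis mult.commute mult.left_commute mult_1)
qed

lemma numeral_mult_cancel:
  assumes "numeral k * x = numeral k * (y::'a)"
  shows "x = y"
  using of_nat_mult_cancel[of "numeral k" x y] assms by simp

definition half :: 'a where
  "half = (SOME r. 0 \<le> r \<and> of_nat 2 * r = 1)"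

lemma half: "0 \<le> half" "2 * half = 1" "half * 2 = 1"
proof -
  have *: "0 \<le> half \<and> of_nat 2 * half = 1"
    unfolding half_def by (rule someI_ex) (rule nat_inverse, simp)
  then show "0 \<le> half" "2 * half = 1"
    by simp_all
  then show "half * 2 = 1"
    by (simp add: mult.commute)
qed

lemma pos_unit_1: "pos_unit (1::'a)"
  using zero_le_1 by (auto simp: pos_unit_def intro!: exI[of _ 1])

lemma zero_le_2: "0 \<le> (2::'a)"
  using add_nonneg_nonneg[OF zero_le_1 zero_le_1] by simp

lemma pos_unit_2: "pos_unit (2::'a)" and pos_unit_half: "pos_unit half"
  using half zero_le_2 unfolding pos_unit_def by blast+

lemma nonneg_mat_1: "nonneg_mat (mat 1 :: 'a ^ 'n ^ 'n)"
  using zero_le_1 by (simp add: nonneg_mat_def mat_def)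

lemma scale_at_units: "scale_at k (2::'a) \<in> diag_units" "scale_at k half \<in> diag_units"
  unfolding diag_units_iff scale_at_def
  by (rule exI, rule conjI, rule refl, simp add: pos_unit_1 pos_unit_2 pos_unit_half)+

lemma scale_at_inverse: "scale_at k 2 ** scale_at k half = mat 1"
  unfolding scale_at_def diag_mult_diag by (simp add: half vec_eq_iff diag_matrix_component mat_def)

text \<open>
  Conjugation by \<open>diag(1,\<dots>,2,\<dots>,1)\<close> multiplies the two factors of \<open>x\<^sub>i\<^sub>j x\<^sub>j\<^sub>k\<close> by different
  powers of \<open>2\<close>, depending on which copy of \<open>X\<close> in the product is conjugated. So a matrix
  commuting with these conjugates has no path of length two through \<open>j\<close>.
\<close>

lemma no_path_if_commutes_conjugates:
  fixes X :: "'a ^ 'n ^ 'n"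
  assumes comm: "X ** (scale_at j 2 ** X ** scale_at j half) =
    (scale_at j 2 ** X ** scale_at j half) ** X"
    and "i \<noteq> j" "k \<noteq> j"
  shows "X $ i $ j * X $ j $ k = 0"
proof -
  define S where "S = (\<Sum>l\<in>UNIV - {j}. X $ i $ l * X $ l $ k)"
  have "2 * (X $ i $ j * X $ j $ k) + S = half * (X $ i $ j * X $ j $ k) + S"
    using arg_cong[OF comm, of "\<lambda>Y. Y $ i $ k"] assms(2,3)
    unfolding scale_at_def conj_diag_left conj_diag_right S_def
    by (simp add: sum.remove[of UNIV j])
  then have "2 * (2 * (X $ i $ j * X $ j $ k)) = 2 * (half * (X $ i $ j * X $ j $ k))"
    by simp
  then have "4 * (X $ i $ j * X $ j $ k) = X $ i $ j * X $ j $ k"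
    by (simp add: mult.assoc[symmetric] half)
  then have "3 * (X $ i $ j * X $ j $ k) = 3 * 0"
    by (simp add: algebra_simps)
  then show ?thesis
    by (rule numeral_mult_cancel)
qed

lemma diag_commutes_if_commutes_conjugates:
  fixes X :: "'a ^ 'n ^ 'n"
  assumes comm: "\<And>j. X ** (scale_at j 2 ** X ** scale_at j half) =
    (scale_at j 2 ** X ** scale_at j half) ** X"
    and "i \<noteq> k"
  shows "X $ i $ i * X $ i $ k = X $ i $ k * X $ k $ k"
proof -
  have zero: "X $ i $ l * X $ l $ k = 0" if "l \<notin> {i, k}" for l
    using no_path_if_commutes_conjugates[OF comm, of i l k] that by auto
  have split: "(\<Sum>l\<in>UNIV. h l * (X $ i $ l * X $ l $ k)) =
      (\<Sum>l\<in>{i, k}. h l * (X $ i $ l * X $ l $ k))" for h :: "'n \<Rightarrow> 'a"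
    by (rule sum.mono_neutral_right) (use zero in auto)
  have "2 * (X $ i $ i * X $ i $ k) + X $ i $ k * X $ k $ k =
      X $ i $ i * X $ i $ k + 2 * (X $ i $ k * X $ k $ k)"
    using arg_cong[OF comm[of i], of "\<lambda>Y. Y $ i $ k"] assms(2)
    unfolding scale_at_def conj_diag_left conj_diag_right split
    by (simp add: half mult.assoc[symmetric])
  then show ?thesis
    by (simp add: algebra_simps)
qed

text \<open>
  Conjugates of diagonal units by units are diagonal, and diagonal matrices commute. Conversely, a
  unit \<open>g\<close> commuting with its conjugates by \<open>diag(1,\<dots>,2,\<dots>,1)\<close> satisfies \<open>g\<^sub>i\<^sub>j g\<^sub>j\<^sub>k = 0\<close> for \<open>j \<noteq> i, k\<close>. In
  \<open>g\<^sub>i\<^sub>j = \<Sum>\<^sub>k g\<^sub>i\<^sub>j g\<^sub>j\<^sub>k h\<^sub>k\<^sub>j\<close> with \<open>h = g\<inverse>\<close> and \<open>i \<noteq> j\<close> this leaves only \<open>k = j\<close>, where \<open>g\<^sub>i\<^sub>j h\<^sub>j\<^sub>j = 0\<close>.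
  The description uses the multiplication only, so automorphisms respect it.
\<close>

lemma diag_units_characterisation:
  fixes g :: "'a ^ 'n ^ 'n"
  shows "g \<in> diag_units \<longleftrightarrow> g \<in> nonneg_GL_units \<and>
    (\<forall>h\<in>nonneg_GL_units. \<forall>h'\<in>nonneg_GL_units. h ** h' = mat 1 \<longrightarrow>
       g ** (h ** g ** h') = (h ** g ** h') ** g)"
proof
  assume g: "g \<in> diag_units"
  have "g ** (h ** g ** h') = (h ** g ** h') ** g"
    if "h \<in> nonneg_GL_units" "h' \<in> nonneg_GL_units" "h ** h' = mat 1" for h h'
  proof -
    have "h ** g ** h' \<in> diag_units"
      using that units_inverse_in_units(2)[OF that(1,3)] g
      by (intro diag_units_conj) (auto simp: units_iff)
    then obtain f f' where "h ** g ** h' = diag_matrix f" "g = diag_matrix f'"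
      using g diag_unitsD(1) by blast
    then show ?thesis
      by (metis diag_mult_commute)
  qed
  with g show "g \<in> nonneg_GL_units \<and> (\<forall>h\<in>nonneg_GL_units. \<forall>h'\<in>nonneg_GL_units.
      h ** h' = mat 1 \<longrightarrow> g ** (h ** g ** h') = (h ** g ** h') ** g)"
    by (simp add: diag_units_def)
next
  assume g: "g \<in> nonneg_GL_units \<and> (\<forall>h\<in>nonneg_GL_units. \<forall>h'\<in>nonneg_GL_units.
      h ** h' = mat 1 \<longrightarrow> g ** (h ** g ** h') = (h ** g ** h') ** g)"
  then obtain h where h: "nonneg_mat g" "nonneg_mat h" "g ** h = mat 1" "h ** g = mat 1"
    by (auto simp: units_iff)
  have in_units: "d \<in> nonneg_GL_units" if "d \<in> diag_units" for d :: "'a ^ 'n ^ 'n"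
    using that by (simp add: diag_units_def)
  have "g ** (scale_at j 2 ** g ** scale_at j half) = (scale_at j 2 ** g ** scale_at j half) ** g" for j
    using g[THEN conjunct2, rule_format, OF scale_at_units[THEN in_units] scale_at_inverse] .
  then have zero: "g $ i $ j * g $ j $ k = 0" if "i \<noteq> j" "k \<noteq> j" for i j k
    using no_path_if_commutes_conjugates that by blast
  have "g $ i $ j = 0" if "i \<noteq> j" for i j
  proof -
    have "g $ i $ j = g $ i $ j * (g ** h) $ j $ j"
      by (simp add: h mat_def)
    also have "\<dots> = (\<Sum>k\<in>UNIV. g $ i $ j * g $ j $ k * h $ k $ j)"
      by (simp add: mult_component sum_distrib_left mult.assoc)
    also have "\<dots> = 0"
    proof (rule sum.neutral, rule)
      fix k
      show "g $ i $ j * g $ j $ k * h $ k $ j = 0"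
      proof (cases "k = j")
        case True
        \<comment> \<open>The path \<open>i \<rightarrow> j \<rightarrow> j\<close> is an off-diagonal term of \<open>gh = I\<close>.\<close>
        have "g $ i $ j * h $ j $ j = 0"
          by (rule unit_inverse_terms[OF h(1-3) that])
        then show ?thesis
          by (metis True mult.commute mult.assoc mult_zero_left)
      qed (simp add: zero that)
    qed
    finally show ?thesis .
  qed
  then show "g \<in> diag_units"
    using g by (simp add: diag_units_def)
qed

lemma root_elements_commute:
  fixes X :: "'a ^ 'n ^ 'n"
  assumes "X \<in> root_elements"
  shows "X ** (scale_at j 2 ** X ** scale_at j half) = (scale_at j 2 ** X ** scale_at j half) ** X"
proof -
  have "\<forall>d\<in>diag_units. \<forall>d'\<in>diag_units. d ** d' = mat 1 \<longrightarrow>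
      X ** (d ** X ** d') = (d ** X ** d') ** X"
    using assms by (simp add: root_elements_def)
  from this[rule_format, OF scale_at_units scale_at_inverse] show ?thesis .
qed

lemma root_elements_offdiag:
  fixes X :: "'a ^ 'n ^ 'n"
  assumes "X \<in> root_elements" "i \<noteq> j" "k \<noteq> j"
  shows "X $ i $ j * X $ j $ k = 0"
  using no_path_if_commutes_conjugates[OF root_elements_commute] assms by blast

text \<open>
  A root element \<open>X\<close> is \<open>\<Delta> + N\<close> with \<open>N\<^sup>2 = 0\<close> and \<open>\<Delta>\<close> diagonal. Being conjugate to its square
  by a diagonal matrix makes \<open>\<Delta>\<close> idempotent; then \<open>\<Delta>X\<^sup>2 = X\<^sup>2\<close>, and \<open>X\<close> is invertible.
\<close>

lemma root_elements_diag:
  fixes X :: "'a ^ 'n ^ 'n"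
  assumes "X \<in> root_elements"
  shows "X $ i $ i = 1"
proof -
  have inv: "invertible X"
    using assms by (simp add: root_elements_def nonneg_GL_iff)
  obtain d d' where d: "d \<in> diag_units" "d' \<in> diag_units" "d ** d' = mat 1" "d ** X ** d' = X ** X"
    using assms by (auto simp: root_elements_def)
  obtain f g where fg: "d = diag_matrix f" "d' = diag_matrix g"
    using d(1,2) diag_unitsD(1) by blast
  have fg1: "f l * g l = 1" for l
    using arg_cong[OF d(3), of "\<lambda>Y. Y $ l $ l"]
    by (simp add: fg diag_mult_diag diag_matrix_component mat_def)
  have square_diag: "(X ** X) $ l $ l = X $ l $ l * X $ l $ l" for l
  proof -
    have "(X ** X) $ l $ l = (\<Sum>m\<in>{l}. X $ l $ m * X $ m $ l)"
      unfolding mult_component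
      by (rule sum.mono_neutral_right) (simp_all add: root_elements_offdiag[OF assms])
    then show ?thesis
      by simp
  qed
  have idem: "X $ l $ l * X $ l $ l = X $ l $ l" for l
  proof -
    have "X $ l $ l * X $ l $ l = f l * X $ l $ l * g l"
      unfolding square_diag[symmetric] d(4)[symmetric] by (simp add: fg)
    also have "\<dots> = X $ l $ l"
      using fg1[of l] by (metis mult.commute mult.left_commute mult_1)
    finally show ?thesis .
  qed
  define e where "e = diag_matrix (\<lambda>l. X $ l $ l)"
  have "(e ** (X ** X)) $ l $ m = (X ** X) $ l $ m" for l m
  proof (cases "l = m")
    case True
    then show ?thesis
      by (simp add: e_def square_diag idem mult.assoc)
  next
    case False
    have "X $ l $ t * X $ t $ m = 0" if "t \<notin> {l, m}" for t
      using root_elements_offdiag[OF assms, of l t m] that by auto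
    then have "(X ** X) $ l $ m = (\<Sum>t\<in>{l, m}. X $ l $ t * X $ t $ m)"
      unfolding mult_component by (intro sum.mono_neutral_right) auto
    also have "\<dots> = X $ l $ l * X $ l $ m + X $ l $ m * X $ m $ m"
      using False by simp
    also have "X $ l $ m * X $ m $ m = X $ l $ l * X $ l $ m"
      using diag_commutes_if_commutes_conjugates[OF root_elements_commute] assms False by metis
    finally have "(X ** X) $ l $ m = X $ l $ l * (X $ l $ m + X $ l $ m)"
      by (simp add: distrib_left)
    then show ?thesis
      by (simp add: e_def mult.assoc[symmetric] idem)
  qed
  then have eXX: "e ** (X ** X) = mat 1 ** (X ** X)"
    by (simp add: vec_eq_iff)
  obtain Y where Y: "(X ** X) ** Y = mat 1"
    using invertible_mult_comm_ring[OF inv inv] by (auto simp: invertible_def)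
  have "e = mat 1"
    by (rule mat_cancel_right[OF Y eXX])
  then have "e $ i $ i = mat 1 $ i $ i"
    by simp
  then show ?thesis
    by (simp add: e_def diag_matrix_component mat_def)
qed

text \<open>
  All edges of \<open>K\<close> run from \<open>A\<close> to its complement, so there are no paths of length two, and conjugation
  by the diagonal matrix with entries \<open>2\<close> on \<open>A\<close> and \<open>1\<close> elsewhere doubles \<open>K\<close>.
\<close>

lemma one_plus_in_root_elements:
  fixes K :: "'a ^ 'n ^ 'n"
  assumes "nonneg_mat K" and supp: "\<And>i j. K $ i $ j \<noteq> 0 \<Longrightarrow> i \<in> A \<and> j \<notin> A"
  shows "mat 1 + K \<in> root_elements"
proof -
  have path: "K $ i $ j = 0 \<or> K $ j $ k = 0" for i j k
    using supp by blast
  have KdK: "K ** (diag_matrix f ** K ** diag_matrix g) = 0"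
      "(diag_matrix f ** K ** diag_matrix g) ** K = 0" for f g
    using path by (safe intro!: mult_0_from_terms) (simp, metis mult_zero_left mult_zero_right)+
  have KK: "K ** K = 0"
    using path by (intro mult_0_from_terms) (metis mult_zero_left mult_zero_right)
  have "(mat 1 + K) ** (mat 1 - K) = mat 1" "(mat 1 - K) ** (mat 1 + K) = mat 1"
    by (simp_all add: mat_distribs KK)
  then have "mat 1 + K \<in> nonneg_GL"
    using nonneg_mat_add[OF nonneg_mat_1 assms(1)] by (auto simp: nonneg_GL_iff invertible_def)
  moreover have "(mat 1 + K) ** (d ** (mat 1 + K) ** d') = (d ** (mat 1 + K) ** d') ** (mat 1 + K)"
    if dd': "d \<in> diag_units" "d' \<in> diag_units" "d ** d' = mat 1" for d d'
  proof -
    obtain f g where fg: "d = diag_matrix f" "d' = diag_matrix g"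
      using dd'(1,2) diag_unitsD(1) by blast
    have "d ** (mat 1 + K) ** d' = mat 1 + d ** K ** d'"
      by (simp add: mat_distribs dd'(3))
    moreover have "K ** (d ** K ** d') = 0" "(d ** K ** d') ** K = 0"
      using KdK by (simp_all add: fg)
    ultimately show ?thesis
      by (simp add: mat_distribs)
  qed
  moreover
  define d where "d = (diag_matrix (\<lambda>i. if i \<in> A then 2 else 1) :: 'a ^ 'n ^ 'n)"
  define d' where "d' = (diag_matrix (\<lambda>i. if i \<in> A then half else 1) :: 'a ^ 'n ^ 'n)"
  have units: "d \<in> diag_units" "d' \<in> diag_units"
    unfolding d_def d'_def diag_units_iff
    by (rule exI, rule conjI, rule refl, simp add: pos_unit_1 pos_unit_2 pos_unit_half)+
  have one: "d ** d' = mat 1"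
    by (simp add: d_def d'_def diag_mult_diag vec_eq_iff diag_matrix_component mat_def half)
  have "(d ** K ** d') $ i $ j = (K + K) $ i $ j" for i j
    using supp[of i j] by (cases "K $ i $ j = 0") (auto simp: d_def d'_def)
  then have "d ** K ** d' = K + K"
    by (simp add: vec_eq_iff)
  then have "d ** (mat 1 + K) ** d' = (mat 1 + K) ** (mat 1 + K)"
    by (simp add: mat_distribs one KK)
  ultimately show ?thesis
    using units one unfolding root_elements_def by blast
qed

lemma elem_matrix_root:
  assumes "i \<noteq> j" "0 \<le> x"
  shows "elem_matrix i j x \<in> (root_elements :: ('a ^ 'n ^ 'n) set)"
  unfolding elem_matrix_eq
  by (rule one_plus_in_root_elements[where A = "{i}"])
    (use assms in \<open>simp_all add: nonneg_mat_def single_entry_def split: if_splits\<close>)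

lemma elem_matrix_in_nonneg_GL:
  "i \<noteq> j \<Longrightarrow> 0 \<le> x \<Longrightarrow> elem_matrix i j x \<in> (nonneg_GL :: ('a ^ 'n ^ 'n) set)"
  using elem_matrix_root by (auto simp: root_elements_def)

text \<open>
  A root element is the product of the \<open>I + x\<^sub>i\<^sub>j E\<^sub>i\<^sub>j\<close> over all \<open>i \<noteq> j\<close>, in any order, because the mixed
  products \<open>x\<^sub>i\<^sub>j x\<^sub>j\<^sub>k E\<^sub>i\<^sub>k\<close> vanish.
\<close>

lemma root_elements_induct [consumes 1, case_names one mult]:
  fixes X :: "'a ^ 'n ^ 'n"
  assumes X: "X \<in> root_elements"
    and one: "P (mat 1)"
    and mult: "\<And>A i j x. A \<in> nonneg_GL \<Longrightarrow> P A \<Longrightarrow> i \<noteq> j \<Longrightarrow> 0 \<le> x \<Longrightarrow> P (A ** elem_matrix i j x)"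
  shows "P X"
proof -
  have X0: "0 \<le> X $ i $ j" for i j
    using X by (auto simp: root_elements_def nonneg_GL_iff nonneg_mat_def)
  let ?E = "\<lambda>p. single_entry (fst p) (snd p) (X $ fst p $ snd p)"
  have gen: "mat 1 + sum ?E F \<in> nonneg_GL \<and> P (mat 1 + sum ?E F)" if "F \<subseteq> {p. fst p \<noteq> snd p}" for F
    using finite[of F] that
  proof (induction F rule: finite_induct)
    case empty
    show ?case
      using one nonneg_mat_1 by (auto simp: nonneg_GL_iff invertible_def intro: exI[of _ "mat 1"])
  next
    case (insert p F)
    let ?B = "elem_matrix (fst p) (snd p) (X $ fst p $ snd p)"
    have "(mat 1 + sum ?E F) ** ?B \<in> nonneg_GL \<and> P ((mat 1 + sum ?E F) ** ?B)"
      using insert X0 by (intro conjI nonneg_GL_mult elem_matrix_in_nonneg_GL mult) auto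
    moreover have "?E q ** ?E p = 0" if "q \<in> F" for q
      using root_elements_offdiag[OF X, of "fst q" "snd q" "snd p"] that insert.prems
      by (cases "snd q = fst p") (auto simp: single_entry_mult)
    ultimately show ?case
      using insert.hyps by (simp add: elem_matrix_eq mat_distribs mat_mult_sum_left add_ac)
  qed
  have X_eq: "X = mat 1 + sum ?E {p. fst p \<noteq> snd p}"
  proof -
    have "(sum ?E {p. fst p \<noteq> snd p}) $ k $ l = (if k \<noteq> l then X $ k $ l else 0)" for k l
    proof -
      have "(sum ?E {p. fst p \<noteq> snd p}) $ k $ l =
          (\<Sum>p\<in>{p. fst p \<noteq> snd p}. if (k, l) = p then X $ k $ l else 0)"
        unfolding sum_component by (rule sum.cong) (auto simp: single_entry_def)
      then show ?thesis
        by simp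
    qed
    then show ?thesis
      using root_elements_diag[OF X] by (auto simp: vec_eq_iff mat_def)
  qed
  have "P (mat 1 + sum ?E {p. fst p \<noteq> snd p})"
    using gen by blast
  then show ?thesis
    by (simp only: X_eq[symmetric])
qed

end

section \<open>A relation that produces matrix units\<close>

context nonneg_nat_inverses
begin

lemma double_cancel:
  assumes "x + x = y + (y::'a)"
  shows "x = y"
proof -
  have "2 * x = 2 * y"
    using assms by (simp only: mult_2)
  then show ?thesis
    by (rule numeral_mult_cancel)
qed

lemma double_cancel_mat: "X + X = Y + Y \<Longrightarrow> X = (Y :: 'a ^ 'n ^ 'n)"
  using double_cancel by (simp add: vec_eq_iff)

text \<open>
  The map \<open>x \<mapsto> f x g\<inverse>\<close> acts on \<open>a\<close>, \<open>b\<close>, \<open>c\<close> by the distinct scalars \<open>2\<close>, \<open>1\<close>, \<open>1/2\<close>, so a vanishing sum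
  splits. Twice this map has the integral scalars \<open>4\<close>, \<open>2\<close>, \<open>1\<close>; iterating it gives a Vandermonde
  system.
\<close>

lemma graded_separation:
  fixes a b c f g g' :: 'a
  assumes a: "f * a = 2 * (a * g)" and b: "f * b = b * g" and c: "2 * (f * c) = c * g"
    and g: "g * g' = 1" and sum: "a + b + c = 0"
  shows "a = 0" "b = 0" "c = 0"
proof -
  have cancel: "x = 0" if "x * g = 0" for x
    using that g by (metis mult.assoc mult_1_right mult_zero_left)
  have shift: "(4 * x * a + 2 * y * b + z * c) = 0" if "x * a + y * b + z * c = 0" for x y z
  proof (rule cancel)
    have "(4 * x * a + 2 * y * b + z * c) * g =
        2 * x * (2 * (a * g)) + 2 * y * (b * g) + z * (c * g)"
      by (simp add: algebra_simps)
    also have "\<dots> = 2 * f * (x * a + y * b + z * c)"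
      unfolding a[symmetric] b[symmetric] c[symmetric] by (simp add: algebra_simps)
    finally show "(4 * x * a + 2 * y * b + z * c) * g = 0"
      using that by simp
  qed
  have 1: "4 * a + 2 * b + c = 0"
    using shift[of 1 1 1] sum by simp
  have 2: "16 * a + 4 * b + c = 0"
    using shift[of 4 2 1] 1 by simp
  have "6 * a = (16 * a + 4 * b + c) - 3 * (4 * a + 2 * b + c) + 2 * (a + b + c)"
    by (simp add: algebra_simps)
  then have "6 * a = 6 * 0"
    unfolding 1 2 sum by simp
  then show a0: "a = 0"
    by (rule numeral_mult_cancel)
  have "b = (4 * a + 2 * b + c) - (a + b + c) - 3 * a"
    by (simp add: algebra_simps)
  then have "b = 0 - 0 - 3 * a"
    unfolding 1 sum .
  then have b0: "b = 0"
    by (simp add: a0)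
  then show "b = 0" "c = 0"
    using sum a0 b0 by simp_all
qed

text \<open>
  For \<open>N = E\<^sub>1\<^sub>2\<close>, \<open>M = E\<^sub>2\<^sub>1\<close>, \<open>F\<^sub>1 = diag(2,1)\<close>, \<open>F\<^sub>2 = diag(1,2)\<close> the last assumption equates an
  upper-lower with a lower-upper triangular factorisation. It replaces the Weyl element relation of
  \<open>SL\<^sub>2\<close>, which needs negative entries. Conjugation by \<open>F\<^sub>1\<close> gives \<open>N\<close> and \<open>M\<close> the degrees \<open>1\<close> and
  \<open>-1\<close>; comparing terms of equal degree gives \<open>F\<^sub>2 N = N F\<^sub>1\<close>, \<open>F\<^sub>2 M = M F\<^sub>1\<close> and
  \<open>F\<^sub>2 + F\<^sub>2 N M = F\<^sub>1 + M N F\<^sub>1\<close>. Multiplying the last equation by \<open>N\<close> and \<open>M\<close> yields \<open>NMN = N\<close> and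
  \<open>MNM = M\<close>. Off the diagonal it says that \<open>NM\<close> and \<open>MN\<close> agree up to units; as these idempotents are
  nonnegative and orthogonal, they have to be diagonal.
\<close>

lemma matrix_unit_pair:
  fixes F1 F2 N M :: "'a ^ 'n ^ 'n"
  assumes diag: "F1 \<in> diag_units" "F2 \<in> diag_units"
    and nonneg: "nonneg_mat N" "nonneg_mat M"
    and square: "N ** N = 0" "M ** M = 0"
    and F1N: "F1 ** N = N ** F1 + N ** F1"
    and MF1: "M ** F1 = F1 ** M + F1 ** M"
    and rel: "F2 ** (mat 1 + N) ** (mat 1 + M) = (mat 1 + M) ** (mat 1 + N) ** F1"
  shows "N ** M ** N = N" "M ** N ** M = M"
    and "i \<noteq> j \<Longrightarrow> (N ** M) $ i $ j = 0" "i \<noteq> j \<Longrightarrow> (M ** N) $ i $ j = 0"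
proof -
  note assoc = matrix_mul_assoc
  obtain f1 f2 where f: "F1 = diag_matrix f1" "F2 = diag_matrix f2"
      "\<And>i. pos_unit (f1 i)" "\<And>i. pos_unit (f2 i)"
    using diag diag_units_iff by metis
  obtain g1 g2 where g: "\<And>i. f1 i * g1 i = 1" "\<And>i. f2 i * g2 i = 1"
    using f(3,4) unfolding pos_unit_def by metis
  have inv: "diag_matrix g1 ** F1 = mat 1" "F1 ** diag_matrix g1 = mat 1"
      "diag_matrix g2 ** F2 = mat 1"
    by (simp_all add: f diag_mult_diag g mult.commute[of "g1 _"] mult.commute[of "g2 _"])
  have F1NM: "F1 ** (N ** M) = (N ** M) ** F1"
  proof -
    have "F1 ** (N ** M) = N ** (F1 ** M + F1 ** M)"
      by (simp only: assoc F1N mat_distribs)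
    then show ?thesis
      by (simp only: MF1[symmetric] assoc)
  qed
  have F1MN: "F1 ** (M ** N) = (M ** N) ** F1"
  proof (rule double_cancel_mat)
    have "F1 ** (M ** N) + F1 ** (M ** N) = (F1 ** M + F1 ** M) ** N"
      by (simp only: assoc mat_distribs)
    also have "\<dots> = M ** (F1 ** N)"
      by (simp only: MF1[symmetric] assoc)
    also have "\<dots> = M ** N ** F1 + M ** N ** F1"
      by (simp only: F1N mat_distribs assoc)
    finally show "F1 ** (M ** N) + F1 ** (M ** N) = M ** N ** F1 + M ** N ** F1" .
  qed
  define a where "a = F2 ** N - N ** F1"
  define b where "b = F2 - F1 + F2 ** (N ** M) - (M ** N) ** F1"
  define c where "c = F2 ** M - M ** F1"
  have F12: "F1 ** F2 = F2 ** F1"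
    by (simp add: f diag_mult_commute)
  have abc: "a + b + c = 0"
    using rel unfolding a_def b_def c_def by (simp add: mat_distribs assoc algebra_simps)
  have deg_a: "F1 ** a = a ** F1 + a ** F1"
  proof -
    have "F1 ** (F2 ** N) = F2 ** (F1 ** N)"
      by (simp only: assoc F12)
    then show ?thesis
      unfolding a_def by (simp only: mat_distribs F1N assoc add_diff_add)
  qed
  have deg_b: "F1 ** b = b ** F1"
  proof -
    have "F1 ** (F2 ** (N ** M)) = F2 ** (F1 ** (N ** M))"
      by (simp add: assoc F12)
    moreover have "F1 ** ((M ** N) ** F1) = (F1 ** (M ** N)) ** F1"
      by (simp add: assoc)
    ultimately show ?thesis
      unfolding b_def by (simp add: mat_distribs F1NM F1MN F12) (simp add: assoc)
  qed
  have deg_c: "F1 ** c + F1 ** c = c ** F1"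
  proof -
    have "F1 ** (F2 ** M) + F1 ** (F2 ** M) = F2 ** (F1 ** M + F1 ** M)"
      by (simp only: assoc F12 mat_distribs)
    also have "\<dots> = F2 ** M ** F1"
      by (simp only: MF1[symmetric] assoc)
    finally have "F1 ** (F2 ** M) + F1 ** (F2 ** M) = F2 ** M ** F1" .
    moreover have "F1 ** (M ** F1) + F1 ** (M ** F1) = (F1 ** M + F1 ** M) ** F1"
      by (simp only: assoc mat_distribs)
    then have "F1 ** (M ** F1) + F1 ** (M ** F1) = M ** F1 ** F1"
      by (simp only: MF1[symmetric])
    ultimately show ?thesis
      unfolding c_def by (simp only: mat_distribs add_diff_add[symmetric])
  qed
  have "a $ k $ l = 0 \<and> b $ k $ l = 0 \<and> c $ k $ l = 0" for k l
  proof -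
    have "f1 k * a $ k $ l = 2 * (a $ k $ l * f1 l)"
      using arg_cong[OF deg_a, of "\<lambda>X. X $ k $ l"]
      by (simp only: f vector_add_component diag_mult_component mult_diag_component mult_2)
    moreover have "f1 k * b $ k $ l = b $ k $ l * f1 l"
      using arg_cong[OF deg_b, of "\<lambda>X. X $ k $ l"] by (simp add: f)
    moreover have "2 * (f1 k * c $ k $ l) = c $ k $ l * f1 l"
      using arg_cong[OF deg_c, of "\<lambda>X. X $ k $ l"]
      by (simp only: f vector_add_component diag_mult_component mult_diag_component mult_2)
    moreover have "a $ k $ l + b $ k $ l + c $ k $ l = 0"
      using arg_cong[OF abc, of "\<lambda>X. X $ k $ l"] by simp
    ultimately show ?thesis
      using graded_separation g(1) by blast
  qed
  then have "a = 0" "b = 0" "c = 0"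
    by (simp_all add: vec_eq_iff)
  then have F2N: "F2 ** N = N ** F1" and F2M: "F2 ** M = M ** F1"
    and deg0: "F2 + F2 ** (N ** M) = F1 + (M ** N) ** F1"
    by (simp_all add: a_def b_def c_def algebra_simps)
  have "F2 ** N + F2 ** (N ** M ** N) = F1 ** N + M ** (N ** (F1 ** N))"
    using arg_cong[OF deg0, of "\<lambda>X. X ** N"] by (simp add: mat_distribs assoc)
  also have "N ** (F1 ** N) = 0"
    by (simp only: F1N mat_distribs assoc square mat_mult_0 add_0)
  also have "F1 ** N + M ** 0 = F2 ** N + F2 ** N"
    by (simp only: F1N F2N mat_mult_0 add_0_right)
  finally have "F2 ** (N ** M ** N) = F2 ** N"
    by simp
  then show NMN: "N ** M ** N = N"
    by (rule mat_cancel_left[OF inv(3)])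
  have "F2 ** M + F2 ** N ** (M ** M) = F1 ** M + M ** N ** (F1 ** M)"
    using arg_cong[OF deg0, of "\<lambda>X. X ** M"] by (simp only: mat_distribs assoc)
  then have "F1 ** M + F1 ** M = F1 ** M + M ** N ** (F1 ** M)"
    by (simp only: square mat_mult_0 add_0_right F2M MF1)
  then have F1M: "M ** N ** (F1 ** M) = F1 ** M"
    by (rule add_left_imp_eq[symmetric])
  have "M ** N ** (M ** F1) = M ** F1"
    by (simp only: MF1 mat_distribs F1M)
  then have "M ** N ** M ** F1 = M ** F1"
    by (simp add: assoc)
  then show MNM: "M ** N ** M = M"
    by (rule mat_cancel_right[OF inv(2)])
  define p r where "p = N ** M" and "r = M ** N"
  have pr: "p ** p = p" "r ** r = r" "p ** r = 0" "r ** p = 0"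
  proof -
    show "p ** p = p" "r ** r = r"
      by (simp_all add: p_def r_def assoc NMN MNM)
    have "p ** r = N ** (M ** M) ** N" "r ** p = M ** (N ** N) ** M"
      by (simp_all add: p_def r_def assoc)
    then show "p ** r = 0" "r ** p = 0"
      by (simp_all add: square)
  qed
  have nonneg_pr: "nonneg_mat p" "nonneg_mat r"
    by (simp_all add: p_def r_def nonneg nonneg_mat_mult)
  have off: "f2 k * p $ k $ l = r $ k $ l * f1 l" if "k \<noteq> l" for k l
    using arg_cong[OF deg0, of "\<lambda>X. X $ k $ l"] that
    by (simp add: f p_def r_def diag_matrix_component)
  have p_off: "p $ k $ l = g2 k * f1 l * r $ k $ l" if "k \<noteq> l" for k l
  proof -
    have "p $ k $ l = g2 k * (f2 k * p $ k $ l)"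
      using g(2)[of k] by (simp add: mult.assoc[symmetric] mult.commute[of "g2 k"])
    then show ?thesis
      by (simp add: off[OF that] mult_ac)
  qed
  have p_diag: "p $ i $ j = 0" if "i \<noteq> j" for i j
  proof -
    have "p $ i $ k * p $ k $ j = 0" for k
    proof (cases "k = j")
      case True
      have "r $ i $ j * p $ j $ j = 0"
        by (rule nonneg_mult_0_terms[OF pr(4) nonneg_pr(2,1)])
      then show ?thesis
        using p_off[OF that] True by (simp add: mult.assoc)
    next
      case False
      have "p $ i $ k * r $ k $ j = 0"
        by (rule nonneg_mult_0_terms[OF pr(3) nonneg_pr])
      then show ?thesis
        unfolding p_off[OF False] by (simp add: mult.left_commute[of "p $ i $ k"])
    qed
    then show ?thesis
      by (subst pr(1)[symmetric]) (simp add: mult_component)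
  qed
  show "i \<noteq> j \<Longrightarrow> (N ** M) $ i $ j = 0"
    using p_diag by (simp add: p_def)
  show "i \<noteq> j \<Longrightarrow> (M ** N) $ i $ j = 0"
  proof -
    assume "i \<noteq> j"
    then have "r $ i $ j * f1 j * g1 j = 0"
      using off[of i j] p_diag[of i j] by simp
    then show "(M ** N) $ i $ j = 0"
      by (simp add: r_def mult.assoc g)
  qed
qed

end

section \<open>Invariance under automorphisms\<close>

locale nonneg_GL_automorphism = nonneg_nat_inverses ring_type
  for ring_type :: "'a::{comm_ring_1, ordered_comm_ring} itself" +
  fixes \<Phi> :: "'a ^ 'n ^ 'n \<Rightarrow> 'a ^ 'n ^ 'n"
  assumes aut: "semigroup_aut nonneg_GL \<Phi>"
    and card3: "3 \<le> CARD('n)"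
begin

lemma third_index: "\<exists>l::'n. l \<noteq> i \<and> l \<noteq> j"
proof (rule ccontr)
  assume "\<nexists>l. l \<noteq> i \<and> l \<noteq> j"
  then have "UNIV \<subseteq> {i, j}"
    by auto
  then have "CARD('n) \<le> card {i, j}"
    by (rule card_mono[rotated]) simp
  then show False
    using card3 card_insert_le_m1[of 2 "{j}" i] by simp
qed

lemma \<Phi>_mult: "A \<in> nonneg_GL \<Longrightarrow> B \<in> nonneg_GL \<Longrightarrow> \<Phi> (A ** B) = \<Phi> A ** \<Phi> B"
  using aut by (simp add: semigroup_aut_def semigroup_hom_def)

lemma \<Phi>_in: "A \<in> nonneg_GL \<Longrightarrow> \<Phi> A \<in> nonneg_GL"
  using aut by (auto simp: semigroup_aut_def semigroup_hom_def)

lemma \<Phi>_eq_iff: "A \<in> nonneg_GL \<Longrightarrow> B \<in> nonneg_GL \<Longrightarrow> \<Phi> A = \<Phi> B \<longleftrightarrow> A = B"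
  using aut by (auto simp: semigroup_aut_def bij_betw_def dest: inj_onD)

lemma \<Phi>_surj: "B \<in> nonneg_GL \<Longrightarrow> \<exists>A\<in>nonneg_GL. \<Phi> A = B"
  using aut unfolding semigroup_aut_def bij_betw_def by (metis imageE)

lemma mat_1_in: "mat 1 \<in> (nonneg_GL :: ('a ^ 'n ^ 'n) set)"
  using nonneg_mat_1 by (auto simp: nonneg_GL_iff invertible_def intro: exI[of _ "mat 1"])

lemma \<Phi>_1: "\<Phi> (mat 1) = mat 1"
proof -
  obtain B where B: "\<Phi> (mat 1) ** B = mat 1" "B ** \<Phi> (mat 1) = mat 1"
    using \<Phi>_in[OF mat_1_in] by (auto simp: nonneg_GL_iff invertible_def)
  have "\<Phi> (mat 1) ** \<Phi> (mat 1) = \<Phi> (mat 1) ** mat 1"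
    using \<Phi>_mult[OF mat_1_in mat_1_in] by simp
  then show ?thesis
    by (rule mat_cancel_left[OF B(2)])
qed

lemma \<Phi>_mult_eq_1:
  "A \<in> nonneg_GL \<Longrightarrow> B \<in> nonneg_GL \<Longrightarrow> \<Phi> A ** \<Phi> B = mat 1 \<longleftrightarrow> A ** B = mat 1"
  using \<Phi>_eq_iff[of "A ** B" "mat 1"] by (simp add: \<Phi>_mult \<Phi>_1 mat_1_in nonneg_GL_mult)

lemma \<Phi>_image: "\<Phi> ` nonneg_GL = nonneg_GL"
  using \<Phi>_in \<Phi>_surj by blast

lemma \<Phi>_units_iff: "A \<in> nonneg_GL \<Longrightarrow> \<Phi> A \<in> nonneg_GL_units \<longleftrightarrow> A \<in> nonneg_GL_units"
proof -
  assume A: "A \<in> nonneg_GL"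
  have "(\<exists>B\<in>\<Phi> ` nonneg_GL. \<Phi> A ** B = mat 1 \<and> B ** \<Phi> A = mat 1) \<longleftrightarrow>
      (\<exists>B\<in>nonneg_GL. A ** B = mat 1 \<and> B ** A = mat 1)"
    using A by (simp add: \<Phi>_mult_eq_1)
  then show ?thesis
    using A \<Phi>_in by (simp add: nonneg_GL_units_def \<Phi>_image)
qed

lemma \<Phi>_units_image: "\<Phi> ` nonneg_GL_units = nonneg_GL_units"
proof
  show "\<Phi> ` nonneg_GL_units \<subseteq> nonneg_GL_units"
    using \<Phi>_units_iff units_in_nonneg_GL by blast
  show "nonneg_GL_units \<subseteq> \<Phi> ` nonneg_GL_units"
  proof
    fix B :: "'a ^ 'n ^ 'n" assume B: "B \<in> nonneg_GL_units"
    then obtain A where "A \<in> nonneg_GL" "\<Phi> A = B"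
      using \<Phi>_surj units_in_nonneg_GL by blast
    then show "B \<in> \<Phi> ` nonneg_GL_units"
      using B \<Phi>_units_iff by blast
  qed
qed

lemma \<Phi>_commute_conj_iff:
  assumes "A \<in> nonneg_GL" "h \<in> nonneg_GL" "h' \<in> nonneg_GL"
  shows "\<Phi> A ** (\<Phi> h ** \<Phi> A ** \<Phi> h') = (\<Phi> h ** \<Phi> A ** \<Phi> h') ** \<Phi> A \<longleftrightarrow>
    A ** (h ** A ** h') = (h ** A ** h') ** A"
  using \<Phi>_eq_iff[of "A ** (h ** A ** h')" "(h ** A ** h') ** A"] assms
  by (simp add: \<Phi>_mult nonneg_GL_mult)

lemma \<Phi>_diag_iff:
  assumes g: "g \<in> nonneg_GL"
  shows "\<Phi> g \<in> diag_units \<longleftrightarrow> g \<in> diag_units"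
proof -
  have "(\<forall>h\<in>\<Phi> ` nonneg_GL_units. \<forall>h'\<in>\<Phi> ` nonneg_GL_units. h ** h' = mat 1 \<longrightarrow>
       \<Phi> g ** (h ** \<Phi> g ** h') = (h ** \<Phi> g ** h') ** \<Phi> g) \<longleftrightarrow>
     (\<forall>h\<in>nonneg_GL_units. \<forall>h'\<in>nonneg_GL_units. h ** h' = mat 1 \<longrightarrow>
       g ** (h ** g ** h') = (h ** g ** h') ** g)"
    unfolding ball_simps(9)
    by (intro ball_cong refl) (simp add: \<Phi>_mult_eq_1 \<Phi>_commute_conj_iff units_in_nonneg_GL g)
  then show ?thesis
    unfolding diag_units_characterisation \<Phi>_units_image using \<Phi>_units_iff[OF g] by blast
qed

lemma diag_in_nonneg_GL: "d \<in> diag_units \<Longrightarrow> d \<in> (nonneg_GL :: ('a ^ 'n ^ 'n) set)"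
  using units_in_nonneg_GL by (auto simp: diag_units_def)

lemma \<Phi>_diag_image: "\<Phi> ` diag_units = diag_units"
proof
  show "\<Phi> ` diag_units \<subseteq> diag_units"
    using \<Phi>_diag_iff diag_in_nonneg_GL by blast
  show "diag_units \<subseteq> \<Phi> ` diag_units"
  proof
    fix B :: "'a ^ 'n ^ 'n" assume B: "B \<in> diag_units"
    then obtain A where "A \<in> nonneg_GL" "\<Phi> A = B"
      using \<Phi>_surj diag_in_nonneg_GL by blast
    then show "B \<in> \<Phi> ` diag_units"
      using B \<Phi>_diag_iff by blast
  qed
qed

lemma \<Phi>_root_iff:
  assumes X: "X \<in> nonneg_GL"
  shows "\<Phi> X \<in> root_elements \<longleftrightarrow> X \<in> root_elements"
proof -
  have "(\<forall>d\<in>\<Phi> ` diag_units. \<forall>d'\<in>\<Phi> ` diag_units. d ** d' = mat 1 \<longrightarrow>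
       \<Phi> X ** (d ** \<Phi> X ** d') = (d ** \<Phi> X ** d') ** \<Phi> X) \<longleftrightarrow>
     (\<forall>d\<in>diag_units. \<forall>d'\<in>diag_units. d ** d' = mat 1 \<longrightarrow>
       X ** (d ** X ** d') = (d ** X ** d') ** X)"
    unfolding ball_simps(9)
    by (intro ball_cong refl) (simp add: \<Phi>_mult_eq_1 \<Phi>_commute_conj_iff diag_in_nonneg_GL X)
  moreover have square: "\<Phi> d ** \<Phi> X ** \<Phi> d' = \<Phi> X ** \<Phi> X \<longleftrightarrow> d ** X ** d' = X ** X"
    if "d \<in> diag_units" "d' \<in> diag_units" for d d'
    using \<Phi>_eq_iff[of "d ** X ** d'" "X ** X"] that X
    by (simp add: \<Phi>_mult diag_in_nonneg_GL nonneg_GL_mult)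
  have "(\<exists>d\<in>\<Phi> ` diag_units. \<exists>d'\<in>\<Phi> ` diag_units. d ** d' = mat 1 \<and> d ** \<Phi> X ** d' = \<Phi> X ** \<Phi> X) \<longleftrightarrow>
     (\<exists>d\<in>diag_units. \<exists>d'\<in>diag_units. d ** d' = mat 1 \<and> d ** X ** d' = X ** X)"
    unfolding bex_simps(7)
    by (intro bex_cong refl) (simp add: \<Phi>_mult_eq_1 square diag_in_nonneg_GL)
  ultimately show ?thesis
    using X \<Phi>_in unfolding root_elements_def \<Phi>_diag_image by blast
qed

end

context nonneg_GL_automorphism
begin

section \<open>Matrix units in the images of the elementary matrices\<close>

lemma scale_in: "scale_at k 2 \<in> (nonneg_GL :: ('a ^ 'n ^ 'n) set)"
  using diag_in_nonneg_GL scale_at_units(1) by blast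

definition N :: "'n \<Rightarrow> 'n \<Rightarrow> 'a \<Rightarrow> 'a ^ 'n ^ 'n" where
  "N i j x = \<Phi> (elem_matrix i j x) - mat 1"

lemma \<Phi>_elem: "\<Phi> (elem_matrix i j x) = mat 1 + N i j x"
  by (simp add: N_def)

lemma \<Phi>_elem_root: "i \<noteq> j \<Longrightarrow> 0 \<le> x \<Longrightarrow> \<Phi> (elem_matrix i j x) \<in> root_elements"
  by (simp add: \<Phi>_root_iff elem_matrix_in_nonneg_GL elem_matrix_root)

lemma N_diag_0: "i \<noteq> j \<Longrightarrow> 0 \<le> x \<Longrightarrow> N i j x $ a $ a = 0"
  using root_elements_diag[OF \<Phi>_elem_root] by (simp add: N_def mat_def)

lemma N_nonneg:
  assumes "i \<noteq> j" "0 \<le> x"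
  shows "nonneg_mat (N i j x)"
proof -
  have "0 \<le> N i j x $ a $ b" for a b
  proof (cases "a = b")
    case False
    have "0 \<le> \<Phi> (elem_matrix i j x) $ a $ b"
      using \<Phi>_in[OF elem_matrix_in_nonneg_GL[OF assms]] by (simp add: nonneg_GL_iff nonneg_mat_def)
    then show ?thesis
      using False by (simp add: N_def mat_def)
  qed (use N_diag_0 assms in simp)
  then show ?thesis
    by (simp add: nonneg_mat_def)
qed

text \<open>
  If \<open>E\<^sub>i\<^sub>j E\<^sub>k\<^sub>l = E\<^sub>k\<^sub>l E\<^sub>i\<^sub>j = 0\<close>, then \<open>I + xE\<^sub>i\<^sub>j + yE\<^sub>k\<^sub>l\<close> is a root element. So is its image, whose
  off-diagonal part has square zero term by term and dominates \<open>N\<^sub>i\<^sub>j(x)\<close> and \<open>N\<^sub>k\<^sub>l(y)\<close>.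
\<close>

lemma N_mult_0:
  assumes ij: "i \<noteq> j" "0 \<le> x" and kl: "k \<noteq> l" "0 \<le> y" and ne: "j \<noteq> k" "i \<noteq> l"
  shows "N i j x ** N k l y = 0"
proof -
  let ?Z = "\<Phi> (elem_matrix i j x ** elem_matrix k l y)"
  have "elem_matrix i j x ** elem_matrix k l y = mat 1 + (single_entry i j x + single_entry k l y)"
    using ne by (simp add: elem_matrix_eq mat_distribs single_entry_mult)
  moreover have "mat 1 + (single_entry i j x + single_entry k l y) \<in> root_elements"
    by (rule one_plus_in_root_elements[where A = "{i, k}"])
      (use assms in \<open>auto simp: nonneg_mat_def single_entry_def split: if_splits\<close>)
  ultimately have Z: "?Z \<in> root_elements"
    using \<Phi>_root_iff elem_matrix_in_nonneg_GL assms nonneg_GL_mult by metis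
  have Z_eq: "?Z = mat 1 + N i j x + N k l y + N i j x ** N k l y"
    using assms by (simp add: \<Phi>_mult elem_matrix_in_nonneg_GL \<Phi>_elem mat_distribs)
  note nn = N_nonneg[OF ij] N_nonneg[OF kl]
  have nnNN: "nonneg_mat (N i j x ** N k l y)"
    by (rule nonneg_mat_mult[OF nn])
  show ?thesis
  proof (rule mult_0_from_terms)
    fix a b c
    let ?n = "N i j x" and ?m = "N k l y"
    show "?n $ a $ b * ?m $ b $ c = 0"
    proof (cases "a = b \<or> b = c")
      case True
      then show ?thesis
        using N_diag_0 assms by auto
    next
      case False
      define u where "u = ?m $ a $ b + (?n ** ?m) $ a $ b"
      define v where "v = ?n $ b $ c + (?n ** ?m) $ b $ c"
      have "?Z $ a $ b * ?Z $ b $ c = 0"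
        using root_elements_offdiag[OF Z] False by auto
      then have "(?n $ a $ b + u) * (?m $ b $ c + v) = 0"
        using False by (simp add: Z_eq u_def v_def mat_def add_ac)
      then have sum: "?n $ a $ b * ?m $ b $ c + (?n $ a $ b * v + u * (?m $ b $ c + v)) = 0"
        by (simp add: algebra_simps)
      have uv: "0 \<le> u" "0 \<le> v"
        using nn nnNN by (simp_all add: u_def v_def nonneg_mat_def)
      have "0 \<le> ?n $ a $ b * ?m $ b $ c" "0 \<le> ?n $ a $ b * v + u * (?m $ b $ c + v)"
        using nn uv by (simp_all add: nonneg_mat_def)
      then show ?thesis
        by (rule nonneg_add_eq_0(1)[OF sum])
    qed
  qed
qed

lemma N_add:
  assumes "i \<noteq> j" "0 \<le> x" "0 \<le> y"
  shows "N i j (x + y) = N i j x + N i j y"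
proof -
  have "elem_matrix i j (x + y) = elem_matrix i j x ** elem_matrix i j y"
    using assms(1) by (simp add: elem_matrix_eq mat_distribs single_entry_mult single_entry_add)
  then have "\<Phi> (elem_matrix i j (x + y)) = \<Phi> (elem_matrix i j x) ** \<Phi> (elem_matrix i j y)"
    using assms by (simp add: \<Phi>_mult elem_matrix_in_nonneg_GL)
  then have "mat 1 + N i j (x + y) = mat 1 + (N i j x + N i j y)"
    using assms by (simp add: \<Phi>_elem mat_distribs N_mult_0 add_ac)
  then show ?thesis
    by (rule add_left_imp_eq)
qed

lemma scale_at_eq: "scale_at k t = mat 1 + single_entry k k (t - 1)"
  by (auto simp: scale_at_def diag_matrix_component vec_eq_iff mat_def single_entry_def)

lemma scale_at_elem_left:
  "i \<noteq> j \<Longrightarrow> scale_at i t ** elem_matrix i j x = elem_matrix i j (t * x) ** scale_at i t"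
  by (auto simp: scale_at_def elem_matrix_eq vec_eq_iff single_entry_def mat_def)

lemma scale_at_elem_right:
  "i \<noteq> j \<Longrightarrow> elem_matrix i j x ** scale_at j t = scale_at j t ** elem_matrix i j (x * t)"
  by (auto simp: scale_at_def elem_matrix_eq vec_eq_iff single_entry_def mat_def)

lemma N_scale_left:
  assumes "i \<noteq> j"
  shows "\<Phi> (scale_at i 2) ** N i j 1 = N i j 1 ** \<Phi> (scale_at i 2) + N i j 1 ** \<Phi> (scale_at i 2)"
proof -
  have "scale_at i 2 ** elem_matrix i j (1::'a) = elem_matrix i j (1 + 1) ** scale_at i 2"
    using scale_at_elem_left[OF assms, of 2 1] by simp
  then have "\<Phi> (scale_at i 2) ** (mat 1 + N i j 1) = (mat 1 + N i j (1 + 1)) ** \<Phi> (scale_at i 2)"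
    using assms zero_le_1 add_nonneg_nonneg[OF zero_le_1 zero_le_1] \<Phi>_mult elem_matrix_in_nonneg_GL scale_in \<Phi>_elem
    by metis
  then show ?thesis
    unfolding N_add[OF assms zero_le_1 zero_le_1]
    by (simp only: mat_distribs matrix_mul_lid matrix_mul_rid add_left_cancel)
qed

lemma N_scale_right:
  assumes "i \<noteq> j"
  shows "N i j 1 ** \<Phi> (scale_at j 2) = \<Phi> (scale_at j 2) ** N i j 1 + \<Phi> (scale_at j 2) ** N i j 1"
proof -
  have "elem_matrix i j (1::'a) ** scale_at j 2 = scale_at j 2 ** elem_matrix i j (1 + 1)"
    using scale_at_elem_right[OF assms, of 1 2] by simp
  then have "(mat 1 + N i j 1) ** \<Phi> (scale_at j 2) = \<Phi> (scale_at j 2) ** (mat 1 + N i j (1 + 1))"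
    using assms zero_le_1 add_nonneg_nonneg[OF zero_le_1 zero_le_1] \<Phi>_mult elem_matrix_in_nonneg_GL scale_in \<Phi>_elem
    by metis
  then show ?thesis
    unfolding N_add[OF assms zero_le_1 zero_le_1]
    by (simp only: mat_distribs matrix_mul_lid matrix_mul_rid add_left_cancel)
qed

lemma N_pair:
  assumes "i \<noteq> j"
  shows "N i j 1 ** N j i 1 ** N i j 1 = N i j 1"
    and "a \<noteq> b \<Longrightarrow> (N i j 1 ** N j i 1) $ a $ b = 0"
proof -
  have "scale_at j 2 ** elem_matrix i j 1 ** elem_matrix j i (1::'a) =
      elem_matrix j i 1 ** elem_matrix i j 1 ** scale_at i 2"
    using assms by (simp add: scale_at_eq elem_matrix_eq mat_distribs single_entry_mult add_ac)
  then have "\<Phi> (scale_at j 2 ** elem_matrix i j 1 ** elem_matrix j i 1) =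
      \<Phi> (elem_matrix j i 1 ** elem_matrix i j 1 ** scale_at i 2)"
    by simp
  then have rel: "\<Phi> (scale_at j 2) ** (mat 1 + N i j 1) ** (mat 1 + N j i 1) =
      (mat 1 + N j i 1) ** (mat 1 + N i j 1) ** \<Phi> (scale_at i 2)"
    using assms zero_le_1 by (simp add: \<Phi>_mult elem_matrix_in_nonneg_GL scale_in nonneg_GL_mult \<Phi>_elem)
  have diag: "\<Phi> (scale_at k 2) \<in> diag_units" for k
    using \<Phi>_diag_iff[OF scale_in] scale_at_units(1) by blast
  note pair = matrix_unit_pair[OF diag diag N_nonneg[OF assms zero_le_1]
      N_nonneg[OF assms[symmetric] zero_le_1] N_mult_0 N_mult_0 N_scale_left[OF assms]
      N_scale_right[OF assms[symmetric]] rel]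
  show "N i j 1 ** N j i 1 ** N i j 1 = N i j 1"
    by (rule pair(1)) (use assms zero_le_1 in auto)
  show "(N i j 1 ** N j i 1) $ a $ b = 0" if "a \<noteq> b"
    by (rule pair(3)) (use assms zero_le_1 that in auto)
qed

lemma N_commutator:
  assumes ne: "k \<noteq> l" "l \<noteq> m" "k \<noteq> m" and x: "0 \<le> x" and y: "0 \<le> y"
  shows "N k l x ** N l m y = N k m (x * y) + N l m y ** N k l x"
proof -
  have xy: "0 \<le> x * y"
    using x y by simp
  have "elem_matrix k l x ** elem_matrix l m y =
      elem_matrix l m y ** elem_matrix k l x ** elem_matrix k m (x * y)"
    using ne by (simp add: elem_matrix_eq mat_distribs single_entry_mult add_ac)
  then have "\<Phi> (elem_matrix k l x ** elem_matrix l m y) =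
      \<Phi> (elem_matrix l m y ** elem_matrix k l x ** elem_matrix k m (x * y))"
    by simp
  then have "(mat 1 + N k l x) ** (mat 1 + N l m y) =
      (mat 1 + N l m y) ** (mat 1 + N k l x) ** (mat 1 + N k m (x * y))"
    using ne x y xy by (simp add: \<Phi>_mult elem_matrix_in_nonneg_GL nonneg_GL_mult \<Phi>_elem)
  moreover have "N l m y ** N k m (x * y) = 0" "N k l x ** N k m (x * y) = 0"
    using ne x y xy by (auto intro!: N_mult_0)
  ultimately show ?thesis
    by (simp add: mat_distribs add_ac matrix_mul_assoc[symmetric])
qed

text \<open>
  Matrix units multiply to \<open>0\<close> in this order. The commutator relation reads \<open>N\<^sub>k\<^sub>l N\<^sub>l\<^sub>m = N\<^sub>k\<^sub>m + Y\<close> with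
  \<open>Y = N\<^sub>l\<^sub>m N\<^sub>k\<^sub>l\<close>. The diagonal idempotents \<open>p = N\<^sub>k\<^sub>l N\<^sub>l\<^sub>k\<close> and \<open>q = N\<^sub>k\<^sub>m N\<^sub>m\<^sub>k\<close> satisfy
  \<open>p N\<^sub>k\<^sub>m = N\<^sub>k\<^sub>m + Y\<close> and therefore \<open>pq - q = Y N\<^sub>m\<^sub>k\<close>. The right side is nonnegative, the left side is
  the negative of the idempotent \<open>q - pq\<close>; such a matrix \<open>A\<close> has \<open>A\<^sup>2 + Aq = 0\<close> and \<open>Aq = A\<close>, so
  it vanishes. Hence \<open>pq = q\<close>, \<open>p N\<^sub>k\<^sub>m = N\<^sub>k\<^sub>m\<close> and \<open>Y = 0\<close>.
\<close>

lemma N_reverse_mult_0: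
  assumes ne: "k \<noteq> l" "l \<noteq> m" "k \<noteq> m"
  shows "N l m 1 ** N k l 1 = 0"
proof -
  note assoc = matrix_mul_assoc
  define p where "p = N k l 1 ** N l k 1"
  define q where "q = N k m 1 ** N m k 1"
  define Y where "Y = N l m 1 ** N k l 1"
  define A where "A = Y ** N m k 1"
  have rel: "N k l 1 ** N l m 1 = N k m 1 + Y"
    using N_commutator[OF ne zero_le_1 zero_le_1] by (simp add: Y_def)
  have nonneg: "nonneg_mat A" "nonneg_mat q"
    unfolding A_def Y_def q_def using ne zero_le_1 by (auto intro!: nonneg_mat_mult N_nonneg)
  have "N l k 1 ** N l m 1 = 0"
    using ne zero_le_1 by (intro N_mult_0) auto
  then have "N l k 1 ** (N k l 1 ** N l m 1) = N l k 1 ** N k m 1"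
    by (simp add: rel matrix_add_ldistrib) (simp add: Y_def assoc)
  then have "N k l 1 ** (N l k 1 ** (N k l 1 ** N l m 1)) = p ** N k m 1"
    by (simp add: p_def assoc)
  moreover have "N k l 1 ** (N l k 1 ** (N k l 1 ** N l m 1)) = N k l 1 ** N l m 1"
    by (simp add: assoc N_pair(1) ne)
  ultimately have pL: "p ** N k m 1 = N k m 1 + Y"
    by (simp add: rel)
  have "p ** q = q + A"
    using arg_cong[OF pL, of "\<lambda>X. X ** N m k 1"]
    by (simp add: q_def A_def assoc mat_distribs)
  then have A: "A = p ** q - q"
    by (simp add: algebra_simps)
  have diag: "p = diag_matrix (\<lambda>a. p $ a $ a)" "q = diag_matrix (\<lambda>a. q $ a $ a)"
    using N_pair(2) ne by (auto simp: p_def q_def vec_eq_iff diag_matrix_component)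
  have comm: "q ** p = p ** q"
    by (subst (1 2) diag(1), subst (1 2) diag(2)) (rule diag_mult_commute)
  have idem: "p ** p = p" "q ** q = q"
    by (simp_all add: p_def q_def assoc N_pair(1) ne)
  have "A ** p = 0"
    unfolding A by (simp add: mat_distribs assoc[symmetric] comm) (simp add: assoc idem)
  moreover have "A ** (q + A) = A ** (p ** q)"
    by (simp add: A)
  ultimately have "A ** q + A ** A = 0"
    by (simp add: mat_distribs assoc)
  then have "A ** q = 0"
    using nonneg nonneg_mat_mult nonneg_mat_add_eq_0(1) by blast
  moreover have "A ** q = A"
    unfolding A by (simp add: mat_distribs assoc[symmetric] idem)
  ultimately have "p ** q = q"
    using A by simp
  moreover have "q ** N k m 1 = N k m 1"
    by (simp add: q_def N_pair(1) ne)
  ultimately have "p ** N k m 1 = N k m 1"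
    by (metis assoc)
  then show ?thesis
    using pL by (simp add: Y_def)
qed

lemma N1_mult_0:
  assumes "i \<noteq> j" "k \<noteq> l" "j \<noteq> k"
  shows "N i j 1 ** N k l 1 = 0"
proof (cases "i = l")
  case True
  then show ?thesis
    using N_reverse_mult_0[of k l j] assms by auto
qed (use assms zero_le_1 in \<open>auto intro: N_mult_0\<close>)

lemma N1_mult:
  assumes "k \<noteq> l" "l \<noteq> m" "k \<noteq> m"
  shows "N k l 1 ** N l m 1 = N k m 1"
  using N_commutator[OF assms zero_le_1 zero_le_1] assms by (simp add: N1_mult_0)

text \<open>
  The system of matrix units completed on the diagonal. The auxiliary index \<open>j\<close> does not matter
  (\<open>E_diag\<close>).
\<close>

definition E :: "'n \<Rightarrow> 'n \<Rightarrow> 'a ^ 'n ^ 'n" where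
  "E k l = (if k = l then let j = SOME j. j \<noteq> k in N k j 1 ** N j k 1 else N k l 1)"

lemma E_offdiag: "k \<noteq> l \<Longrightarrow> E k l = N k l 1"
  by (simp add: E_def)

lemma E_diag:
  assumes "j \<noteq> k"
  shows "E k k = N k j 1 ** N j k 1"
proof -
  have indep: "N k i 1 ** N i k 1 = N k j 1 ** N j k 1" if "i \<noteq> k" for i
  proof (cases "i = j")
    case False
    then have "N k i 1 ** N i k 1 = N k j 1 ** N j i 1 ** N i k 1"
      using assms that by (simp add: N1_mult)
    also have "\<dots> = N k j 1 ** (N j i 1 ** N i k 1)"
      by (rule matrix_mul_assoc[symmetric])
    also have "N j i 1 ** N i k 1 = N j k 1"
      using False assms that by (intro N1_mult) auto
    finally show ?thesis .
  qed simp
  have "(SOME j. j \<noteq> k) \<noteq> k"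
    using assms by (rule someI)
  then show ?thesis
    by (simp add: E_def Let_def indep)
qed

lemma other_index: "\<exists>j::'n. j \<noteq> i"
  using third_index by blast

lemma E_mult: "E i j ** E k l = (if j = k then E i l else 0)"
proof -
  note assoc = matrix_mul_assoc
  consider "i = j" "k = l" | "i = j" "k \<noteq> l" | "i \<noteq> j" "k = l" | "i \<noteq> j" "k \<noteq> l"
    by blast
  then show ?thesis
  proof cases
    case 1
    show ?thesis
    proof (cases "j = k")
      case True
      obtain t where "t \<noteq> k"
        using other_index by blast
      then show ?thesis
        using 1 True by (simp add: E_diag[of t] assoc N_pair(1))
    next
      case False
      have "N j k 1 ** N k j 1 ** (N k j 1 ** N j k 1) = N j k 1 ** (N k j 1 ** N k j 1) ** N j k 1"
        by (simp add: assoc)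
      then show ?thesis
        using 1 False E_diag[of k j] E_diag[of j k] by (simp add: N1_mult_0)
    qed
  next
    case 2
    show ?thesis
    proof (cases "j = k")
      case True
      then show ?thesis
        using 2 by (simp add: E_diag[of l] E_offdiag N_pair(1))
    next
      case False
      obtain t where "t \<noteq> j"
        using other_index by blast
      then have "E j j ** N k l 1 = N j t 1 ** (N t j 1 ** N k l 1)"
        by (simp add: E_diag[of t] assoc)
      then show ?thesis
        using 2 False \<open>t \<noteq> j\<close> by (simp add: E_offdiag N1_mult_0)
    qed
  next
    case 3
    show ?thesis
    proof (cases "j = k")
      case True
      then show ?thesis
        using 3 by (simp add: E_diag[of i] E_offdiag N_pair(1) assoc)
    next
      case False
      obtain t where "t \<noteq> k"
        using other_index by blast
      then have "N i j 1 ** E k k = (N i j 1 ** N k t 1) ** N t k 1"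
        by (simp add: E_diag[of t] assoc)
      then show ?thesis
        using 3 False \<open>t \<noteq> k\<close> by (simp add: E_offdiag N1_mult_0)
    qed
  next
    case 4
    then show ?thesis
      by (cases "i = l") (auto simp: E_offdiag N1_mult_0 N1_mult E_diag)
  qed
qed

lemma E_nonneg: "nonneg_mat (E k l)"
proof (cases "k = l")
  case True
  obtain t where "t \<noteq> k"
    using other_index by blast
  then show ?thesis
    using True zero_le_1 by (auto simp: E_diag[of t] intro!: nonneg_mat_mult N_nonneg)
qed (simp add: E_offdiag N_nonneg zero_le_1)

lemma E_diag_diag: "a \<noteq> b \<Longrightarrow> E k k $ a $ b = 0"
  using other_index[of k] by (auto simp: E_diag N_pair(2))

text \<open>
  Let \<open>Y = E\<^sub>l\<^sub>m N\<^sub>k\<^sub>l(x)\<close> be the error term of the commutator relation for \<open>x\<close> and \<open>1\<close>. Multiplication by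
  \<open>E\<^sub>m\<^sub>m\<close> on the right turns the relation into \<open>N\<^sub>k\<^sub>m(x) E\<^sub>m\<^sub>m = N\<^sub>k\<^sub>m(x) + Y\<close>, and \<open>E\<^sub>l\<^sub>l\<close> on the left
  annihilates every term except \<open>Y\<close>, which it fixes.
\<close>

lemma N_mult_E:
  assumes km: "k \<noteq> m" and x: "0 \<le> x"
  shows "N k m x ** E m m = N k m x"
proof -
  note assoc = matrix_mul_assoc
  obtain l where l: "l \<noteq> k" "l \<noteq> m"
    using third_index by blast
  define Y where "Y = E l m ** N k l x"
  have rel: "N k l x ** E l m = N k m x + Y"
    using N_commutator[of k l m x 1] l km x zero_le_1 by (simp add: Y_def E_offdiag)
  have "N k l x ** E m l = 0"
    using l km x zero_le_1 by (auto simp: E_offdiag intro!: N_mult_0)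
  moreover have "E m m = E m l ** E l m"
    by (simp add: E_mult)
  ultimately have "Y ** E m m = 0"
    by (simp add: Y_def) (metis assoc mat_mult_0)
  moreover have "(N k m x + Y) ** E m m = N k m x + Y"
    by (simp add: rel[symmetric] assoc[symmetric] E_mult)
  ultimately have L: "N k m x ** E m m = N k m x + Y"
    by (simp add: mat_distribs)
  have "E k l ** N k m x = 0"
    using l km x zero_le_1 by (auto simp: E_offdiag intro!: N_mult_0)
  moreover have "E l l = E l k ** E k l"
    by (simp add: E_mult)
  ultimately have "E l l ** N k m x = 0"
    by (simp add: assoc[symmetric])
  moreover have "E l l ** Y = Y"
    by (simp add: Y_def assoc E_mult)
  ultimately have "Y = 0"
    using arg_cong[OF L, of "\<lambda>X. E l l ** X"] by (simp add: mat_distribs assoc)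
  with L show ?thesis
    by simp
qed

text \<open>
  On the complement \<open>s\<close> of the idempotent \<open>\<Sum>\<^sub>k E\<^sub>k\<^sub>k\<close> the images of all root elements act trivially. As
  \<open>\<Phi>\<close> is surjective, these images include \<open>I + E\<^sub>i\<^sub>j\<close> itself, so \<open>E\<^sub>i\<^sub>j s = 0\<close>.
\<close>

lemma E_sum: "(\<Sum>k\<in>UNIV. E k k) = mat 1"
proof -
  define s where "s = mat 1 - (\<Sum>k\<in>UNIV. E k k)"
  have N_s: "N i j x ** s = 0" if "i \<noteq> j" "0 \<le> x" for i j x
  proof -
    have "N i j x ** (\<Sum>k\<in>UNIV. E k k) = N i j x ** (E j j ** (\<Sum>k\<in>UNIV. E k k))"
      using N_mult_E[OF that] by (simp add: matrix_mul_assoc)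
    also have "E j j ** (\<Sum>k\<in>UNIV. E k k) = E j j"
      by (simp add: mat_mult_sum_right E_mult)
    finally show ?thesis
      using N_mult_E[OF that] by (simp add: s_def mat_distribs)
  qed
  have root_s: "\<Phi> X ** s = s" if "X \<in> root_elements" for X
    using that
  proof (induction X rule: root_elements_induct)
    case one
    then show ?case
      by (simp add: \<Phi>_1)
  next
    case (mult A i j x)
    then show ?case
      by (simp add: \<Phi>_mult elem_matrix_in_nonneg_GL \<Phi>_elem mat_distribs matrix_mul_assoc[symmetric] N_s)
  qed
  have "s $ j $ b = 0" for j b
  proof -
    obtain i where i: "i \<noteq> j"
      using other_index by blast
    obtain X where X: "X \<in> nonneg_GL" "\<Phi> X = elem_matrix i j 1"
      using \<Phi>_surj[OF elem_matrix_in_nonneg_GL[OF i zero_le_1]] by blast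
    then have "elem_matrix i j 1 ** s = s"
      using root_s[of X] \<Phi>_root_iff[OF X(1)] elem_matrix_root[OF i zero_le_1] by simp
    then have "single_entry i j 1 ** s = 0"
      by (simp add: elem_matrix_eq mat_distribs)
    then show ?thesis
      using single_entry_mult_component[of i j 1 s i b] by simp
  qed
  then have "s = 0"
    by (simp add: vec_eq_iff)
  then show ?thesis
    by (simp add: s_def)
qed

end

section \<open>The conjugating matrix\<close>

lemma unit_conj_aut:
  fixes h h' :: "'a::{comm_ring_1, ordered_comm_ring} ^ 'n ^ 'n"
  assumes h: "nonneg_mat h" "nonneg_mat h'" "h ** h' = mat 1" "h' ** h = mat 1"
  shows "semigroup_aut nonneg_GL (\<lambda>X. h ** X ** h')"
proof -
  have in_GL: "h \<in> nonneg_GL" "h' \<in> nonneg_GL"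
    using h by (auto simp: nonneg_GL_iff invertible_def)
  have hom: "h ** (X ** Y) ** h' = h ** X ** h' ** (h ** Y ** h')" for X Y
  proof -
    have "h ** X ** h' ** (h ** Y ** h') = h ** X ** (h' ** h) ** Y ** h'"
      by (simp only: matrix_mul_assoc)
    then show ?thesis
      by (simp add: h matrix_mul_assoc)
  qed
  have undo: "h' ** (h ** X ** h') ** h = X" "h ** (h' ** X ** h) ** h' = X" for X
  proof -
    have "h' ** (h ** X ** h') ** h = (h' ** h) ** X ** (h' ** h)"
        "h ** (h' ** X ** h) ** h' = (h ** h') ** X ** (h ** h')"
      by (simp_all only: matrix_mul_assoc)
    then show "h' ** (h ** X ** h') ** h = X" "h ** (h' ** X ** h) ** h' = X"
      by (simp_all add: h)
  qed
  have "bij_betw (\<lambda>X. h ** X ** h') nonneg_GL nonneg_GL"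
    by (rule bij_betw_byWitness[where f' = "\<lambda>X. h' ** X ** h"])
      (simp_all add: undo in_GL nonneg_GL_mult image_subset_iff)
  then show ?thesis
    using in_GL hom by (auto simp: semigroup_aut_def semigroup_hom_def nonneg_GL_mult)
qed

context nonneg_GL_automorphism
begin

lemma E_mult_N:
  assumes km: "k \<noteq> m" and x: "0 \<le> x"
  shows "E k k ** N k m x = N k m x"
proof -
  have "E j j ** N k m x = 0" if "j \<noteq> k" for j
  proof -
    have "E k j ** N k m x = 0"
      using that km x zero_le_1 by (auto simp: E_offdiag intro!: N_mult_0)
    moreover have "E j j = E j k ** E k j"
      by (simp add: E_mult)
    ultimately show ?thesis
      by (simp add: matrix_mul_assoc[symmetric])
  qed
  then have "(\<Sum>j\<in>UNIV. E j j) ** N k m x = (\<Sum>j\<in>{k}. E j j ** N k m x)"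
    unfolding mat_mult_sum_left by (intro sum.mono_neutral_right) auto
  then show ?thesis
    by (simp add: E_sum)
qed

lemma E_idempotent: "E k k $ i $ i * E k k $ i $ i = E k k $ i $ i"
proof -
  have diag: "diag_matrix (\<lambda>i. E k k $ i $ i) = E k k"
    using E_diag_diag by (auto simp: vec_eq_iff diag_matrix_component)
  have "(diag_matrix (\<lambda>i. E k k $ i $ i) ** E k k) $ i $ i = E k k $ i $ i"
    unfolding diag by (simp add: E_mult)
  then show ?thesis
    by (simp only: diag_mult_component)
qed

text \<open>
  All \<open>E\<^sub>k\<^sub>k\<close> have the same trace because \<open>tr AB = tr BA\<close>, and these traces sum to \<open>tr I = n\<close>.
\<close>

lemma E_trace: "(\<Sum>i\<in>UNIV. E k k $ i $ i) = 1"
proof -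
  have eq: "trace (E j j) = trace (E k k)" for j
    using trace_mul_sym[of "E j k" "E k j"] by (simp add: E_mult)
  have "(\<Sum>j\<in>(UNIV::'n set). trace (E j j)) = (\<Sum>j\<in>(UNIV::'n set). trace (E k k))"
    by (rule sum.cong[OF refl eq])
  then have "of_nat CARD('n) * trace (E k k) = (\<Sum>j\<in>(UNIV::'n set). trace (E j j))"
    by simp
  also have "\<dots> = (\<Sum>i\<in>UNIV. (\<Sum>j\<in>UNIV. E j j) $ i $ i)"
    unfolding trace_def sum_component by (rule sum.swap)
  also have "\<dots> = of_nat CARD('n) * 1"
    by (simp add: E_sum mat_def)
  finally have "trace (E k k) = 1"
    by (rule of_nat_mult_cancel) simp
  then show ?thesis
    by (simp add: trace_def)
qed

text \<open>
  Multiplying \<open>1 = \<Sum>\<^sub>j e\<^sub>j\<close> by the idempotent \<open>e\<^sub>i\<close> shows that the products \<open>e\<^sub>i e\<^sub>j\<close> with \<open>j \<noteq> i\<close> sum to \<open>0\<close>.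
\<close>

lemma E_orthogonal:
  assumes "i \<noteq> j"
  shows "E k k $ i $ i * E k k $ j $ j = 0"
proof -
  let ?e = "\<lambda>i. E k k $ i $ i"
  have nn: "0 \<le> ?e i * ?e j" for i j
    using E_nonneg by (simp add: nonneg_mat_def)
  have "?e i = (\<Sum>j\<in>UNIV. ?e i * ?e j)"
    by (simp add: sum_distrib_left[symmetric] E_trace)
  also have "\<dots> = ?e i * ?e i + (\<Sum>j\<in>UNIV - {i}. ?e i * ?e j)"
    by (rule sum.remove) simp_all
  finally have "(\<Sum>j\<in>UNIV - {i}. ?e i * ?e j) = 0"
    by (simp add: E_idempotent)
  then show ?thesis
    using assms nn by (subst (asm) sum_nonneg_eq_0_iff) auto
qed

text \<open>
  The diagonal entries of \<open>E\<^sub>b\<^sub>b\<close> are orthogonal idempotents with sum \<open>1\<close>. The column \<open>v\<close> formed by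
  them therefore spans the image of \<open>E\<^sub>b\<^sub>b\<close> freely, with \<open>v\<^sup>T v = 1\<close> and \<open>v v\<^sup>T = E\<^sub>b\<^sub>b\<close>. The columns of
  the conjugating matrix are the \<open>E\<^sub>k\<^sub>b v\<close>, the rows of its inverse are the \<open>v\<^sup>T E\<^sub>b\<^sub>k\<close>.
\<close>

lemma conjugating_matrix:
  "\<exists>M M'. nonneg_mat M \<and> nonneg_mat M' \<and> M ** M' = mat 1 \<and> M' ** M = mat 1 \<and>
     (\<forall>k l. M' ** E k l ** M = single_entry k l 1)"
proof -
  note assoc = matrix_mul_assoc
  \<comment> \<open>Any base index will do.\<close>
  obtain b :: 'n where True by blast
  define s :: "'n \<Rightarrow> 'n \<Rightarrow> 'a ^ 'n ^ 'n" where "s i j = single_entry i j 1" for i j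
  define V :: "'a ^ 'n ^ 'n" where "V = (\<chi> i j. if j = b then E b b $ i $ i else 0)"
  define V' :: "'a ^ 'n ^ 'n" where "V' = (\<chi> i j. if i = b then E b b $ j $ j else 0)"
  define M where "M = (\<Sum>k\<in>UNIV. E k b ** V ** s b k)"
  define M' where "M' = (\<Sum>k\<in>UNIV. s k b ** V' ** E b k)"
  have s_mult: "s i j ** s k l = (if j = k then s i l else 0)" for i j k l
    by (simp add: s_def single_entry_mult)
  have V'V: "V' ** V = s b b"
    by (auto simp: vec_eq_iff mult_component V_def V'_def s_def single_entry_def E_idempotent E_trace)
  have VV': "V ** V' = E b b"
  proof -
    have "E b b $ i $ i * E b b $ j $ j = E b b $ i $ j" for i j
      by (cases "i = j") (simp_all add: E_idempotent E_orthogonal E_diag_diag)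
    then show ?thesis
      by (simp add: vec_eq_iff mult_component V_def V'_def if_distrib[of "\<lambda>x. _ * x"]
          if_distrib[of "\<lambda>x. x * _"] cong: if_cong)
  qed
  have V_s: "V ** s b b = V"
    by (auto simp: vec_eq_iff s_def mult_single_entry_component V_def)
  have M'E: "M' ** E k l = s k b ** V' ** E b l" for k l
  proof -
    have "M' ** E k l = (\<Sum>j\<in>UNIV. s j b ** V' ** (E b j ** E k l))"
      by (simp add: M'_def mat_mult_sum_left assoc)
    also have "\<dots> = (\<Sum>j\<in>UNIV. if j = k then s k b ** V' ** E b l else 0)"
      by (rule sum.cong) (auto simp: E_mult)
    finally show ?thesis
      by simp
  qed
  have conj: "M' ** E k l ** M = s k l" for k l
  proof -
    have "M' ** E k l ** M = (\<Sum>j\<in>UNIV. s k b ** V' ** (E b l ** E j b) ** V ** s b j)"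
      by (simp add: M'E M_def mat_mult_sum_right assoc)
    also have "\<dots> = (\<Sum>j\<in>UNIV. if j = l then s k b ** V' ** E b b ** V ** s b l else 0)"
      by (rule sum.cong) (auto simp: E_mult)
    also have "\<dots> = s k b ** (V' ** (V ** V') ** V) ** s b l"
      by (simp add: VV' assoc)
    also have "V' ** (V ** V') ** V = (V' ** V) ** (V' ** V)"
      by (simp only: assoc)
    finally show ?thesis
      by (simp add: V'V s_mult)
  qed
  have "M' ** M = M' ** (\<Sum>k\<in>UNIV. E k k) ** M"
    by (simp add: E_sum)
  also have "\<dots> = (\<Sum>k\<in>UNIV. s k k)"
    by (simp add: mat_mult_sum_right mat_mult_sum_left conj)
  also have "\<dots> = mat 1"
  proof -
    have "(\<Sum>k\<in>UNIV. s k k) $ i $ j = (\<Sum>k\<in>UNIV. if k = i then if i = j then 1 else 0 else 0)" for i j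
      unfolding sum_component by (rule sum.cong) (auto simp: s_def single_entry_def)
    then show ?thesis
      by (simp add: vec_eq_iff mat_def)
  qed
  finally have M'M: "M' ** M = mat 1" .
  have "M ** M' = (\<Sum>k\<in>UNIV. E k b ** V ** s b k ** M')"
    by (simp add: M_def mat_mult_sum_left)
  also have "\<dots> = (\<Sum>k\<in>UNIV. E k k)"
  proof (rule sum.cong)
    fix k
    have "s b k ** M' = (\<Sum>j\<in>UNIV. s b k ** s j b ** V' ** E b j)"
      by (simp add: M'_def mat_mult_sum_right assoc)
    also have "\<dots> = (\<Sum>j\<in>UNIV. if j = k then s b b ** V' ** E b k else 0)"
      by (rule sum.cong) (auto simp: s_mult)
    finally have "E k b ** V ** s b k ** M' = E k b ** ((V ** s b b) ** V') ** E b k"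
      by (simp add: assoc[symmetric])
    then show "E k b ** V ** s b k ** M' = E k k"
      by (simp add: V_s VV' E_mult)
  qed simp
  finally have MM': "M ** M' = mat 1"
    by (simp add: E_sum)
  have "0 \<le> E b b $ i $ i" for i
    using E_nonneg nonneg_matD by blast
  then have "nonneg_mat V" "nonneg_mat V'"
    by (simp_all add: nonneg_mat_def V_def V'_def)
  then have "nonneg_mat M" "nonneg_mat M'"
    unfolding M_def M'_def s_def
    by (auto intro!: nonneg_mat_sum nonneg_mat_mult E_nonneg nonneg_single_entry zero_le_1)
  then show ?thesis
    using MM' M'M conj unfolding s_def by blast
qed

end

section \<open>Automorphisms fixing the elementary matrices\<close>

text \<open>
  Now \<open>N\<^sub>i\<^sub>j(x) = E\<^sub>i\<^sub>i N\<^sub>i\<^sub>j(x) E\<^sub>j\<^sub>j\<close> has the single entry \<open>coef i j x\<close>, and the commutator relation, free of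
  its error term, makes these coefficients multiplicative and independent of \<open>i\<close> and \<open>j\<close>.
\<close>

locale normalized_automorphism = nonneg_GL_automorphism ring_type \<Phi>
  for ring_type :: "'a::{comm_ring_1, ordered_comm_ring} itself"
    and \<Phi> :: "'a ^ 'n ^ 'n \<Rightarrow> 'a ^ 'n ^ 'n" +
  assumes fixes_elem: "i \<noteq> j \<Longrightarrow> \<Phi> (elem_matrix i j 1) = elem_matrix i j 1"
begin

lemma N1_eq: "i \<noteq> j \<Longrightarrow> N i j 1 = single_entry i j 1"
  by (simp add: N_def fixes_elem) (simp add: elem_matrix_eq)

lemma E_diag_eq: "E k k = single_entry k k 1"
  using other_index[of k] by (auto simp: E_diag N1_eq single_entry_mult)

definition coef :: "'n \<Rightarrow> 'n \<Rightarrow> 'a \<Rightarrow> 'a" where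
  "coef i j x = N i j x $ i $ j"

lemma N_eq:
  assumes "i \<noteq> j" "0 \<le> x"
  shows "N i j x = single_entry i j (coef i j x)"
proof -
  have "E i i ** N i j x ** E j j = single_entry i j (coef i j x)"
    by (simp add: vec_eq_iff E_diag_eq mult_single_entry_component single_entry_mult_component)
      (simp add: single_entry_def coef_def)
  then show ?thesis
    by (simp add: E_mult_N N_mult_E assms)
qed

lemma coef_1: "i \<noteq> j \<Longrightarrow> coef i j 1 = 1"
  by (simp add: coef_def N1_eq single_entry_def)

lemma coef_mult:
  assumes "i \<noteq> j" "j \<noteq> k" "i \<noteq> k" "0 \<le> x" "0 \<le> y"
  shows "coef i j x * coef j k y = coef i k (x * y)"
proof -
  have "single_entry i k (coef i j x * coef j k y) = single_entry i k (coef i k (x * y))"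
    using N_commutator[OF assms] assms by (simp add: N_eq single_entry_mult)
  then show ?thesis
    by (simp only: single_entry_inject)
qed

text \<open>
  Coefficients in a common row or column agree, and any two positions are joined by such steps; for
  the transposed positions \<open>(i, j)\<close> and \<open>(j, i)\<close> a third index is needed.
\<close>

lemma coef_eq:
  assumes "i \<noteq> j" "k \<noteq> l" and x: "0 \<le> x"
  shows "coef i j x = coef k l x"
proof -
  have row: "coef i j x = coef i k x" if "i \<noteq> j" "i \<noteq> k" for i j k
    using coef_mult[of i j k x 1] that x zero_le_1 by (cases "j = k") (auto simp: coef_1)
  have col: "coef j k x = coef i k x" if "i \<noteq> k" "j \<noteq> k" for i j k
    using coef_mult[of i j k 1 x] that x zero_le_1 by (cases "i = j") (auto simp: coef_1)
  consider "i \<noteq> l" | "i = l" "j \<noteq> k" | "i = l" "j = k"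
    by blast
  then show ?thesis
  proof cases
    case 1
    then show ?thesis
      using row[of i j l] col[of k l i] assms by simp
  next
    case 2
    then show ?thesis
      using col[of k j i] row[of k j i] assms by auto
  next
    case 3
    obtain t where "t \<noteq> i" "t \<noteq> j"
      using third_index by blast
    then show ?thesis
      using 3 row[of i j t] col[of j t i] row[of j t i] assms by auto
  qed
qed

text \<open>The index \<open>undefined\<close> stands for an arbitrary choice.\<close>

definition c :: "'a \<Rightarrow> 'a" where
  "c = (let i = undefined in coef i (SOME j. j \<noteq> i))"

lemma coef_c:
  assumes "i \<noteq> j" "0 \<le> x"
  shows "coef i j x = c x"
proof -
  have "(SOME j. j \<noteq> (undefined :: 'n)) \<noteq> undefined"
    using other_index by (rule someI_ex)
  then show ?thesis
    unfolding c_def Let_def using assms by (intro coef_eq) auto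
qed

lemma \<Phi>_elem_c: "i \<noteq> j \<Longrightarrow> 0 \<le> x \<Longrightarrow> \<Phi> (elem_matrix i j x) = elem_matrix i j (c x)"
  by (simp add: \<Phi>_elem N_eq coef_c) (simp add: elem_matrix_eq)

lemma two_indices: "\<exists>i j :: 'n. i \<noteq> j"
  using other_index by blast

lemma c_nonneg: "0 \<le> x \<Longrightarrow> 0 \<le> c x"
  using two_indices N_nonneg coef_c unfolding coef_def nonneg_mat_def by metis

lemma c_1: "c 1 = 1"
  using two_indices coef_c[OF _ zero_le_1] coef_1 by metis

lemma c_add:
  assumes "0 \<le> x" "0 \<le> y"
  shows "c (x + y) = c x + c y"
proof -
  obtain i j :: 'n where ij: "i \<noteq> j"
    using two_indices by blast
  show ?thesis
    using N_add[OF ij assms] assms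
    by (simp add: coef_c[OF ij, symmetric] coef_def)
qed

lemma c_0: "c 0 = 0"
  using c_add[of 0 0] by simp

lemma c_mult:
  assumes "0 \<le> x" "0 \<le> y"
  shows "c (x * y) = c x * c y"
proof -
  obtain i j k :: 'n where "i \<noteq> j" "j \<noteq> k" "i \<noteq> k"
    using third_index two_indices by metis
  then show ?thesis
    using coef_mult[of i j k x y] assms by (simp add: coef_c)
qed

lemma c_inject:
  assumes "0 \<le> x" "0 \<le> y" "c x = c y"
  shows "x = y"
proof -
  obtain i j :: 'n where ij: "i \<noteq> j"
    using two_indices by blast
  have "\<Phi> (elem_matrix i j x) = \<Phi> (elem_matrix i j y)"
    using assms ij by (simp add: \<Phi>_elem_c)
  then have "elem_matrix i j x = elem_matrix i j y"
    using ij assms \<Phi>_eq_iff elem_matrix_in_nonneg_GL by blast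
  then show ?thesis
    by (simp add: elem_matrix_eq single_entry_inject)
qed

lemma c_sum: "(\<And>i. i \<in> S \<Longrightarrow> 0 \<le> f i) \<Longrightarrow> c (sum f S) = (\<Sum>i\<in>S. c (f i))"
  by (induction S rule: infinite_finite_induct) (simp_all add: c_0 c_add sum_nonneg)

lemma entrywise_mult:
  "nonneg_mat A \<Longrightarrow> nonneg_mat B \<Longrightarrow> entrywise c (A ** B) = entrywise c A ** entrywise c B"
  by (simp add: vec_eq_iff entrywise_def mult_component c_sum c_mult nonneg_mat_def)

lemma entrywise_nonneg: "nonneg_mat A \<Longrightarrow> nonneg_mat (entrywise c A)"
  by (simp add: nonneg_mat_def entrywise_def c_nonneg)

lemma entrywise_scalar: "entrywise c (mat u) = mat (c u)"
  by (simp add: vec_eq_iff entrywise_def mat_def c_0)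

lemma entrywise_elem: "i \<noteq> j \<Longrightarrow> entrywise c (elem_matrix i j x) = elem_matrix i j (c x)"
  by (auto simp: vec_eq_iff entrywise_def elem_matrix_eq mat_def single_entry_def c_0 c_1)

lemma entrywise_inject:
  assumes "nonneg_mat A" "nonneg_mat B" "entrywise c A = entrywise c B"
  shows "A = B"
  using assms c_inject by (simp add: vec_eq_iff entrywise_def nonneg_mat_def)

lemma nonneg_GL_nonneg: "A \<in> nonneg_GL \<Longrightarrow> nonneg_mat A"
  by (simp add: nonneg_GL_iff)

lemma \<Phi>_root: "X \<in> root_elements \<Longrightarrow> \<Phi> X = entrywise c X"
proof (induction X rule: root_elements_induct)
  case one
  then show ?case
    by (simp add: \<Phi>_1 entrywise_scalar c_1)
next
  case (mult A i j x)
  then show ?case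
    by (simp add: \<Phi>_mult elem_matrix_in_nonneg_GL \<Phi>_elem_c entrywise_mult entrywise_elem nonneg_GL_nonneg)
qed

text \<open>A preimage of \<open>I + yE\<^sub>i\<^sub>j\<close> is a root element, so \<open>\<Phi>\<close> acts on it entrywise.\<close>

lemma c_surj:
  assumes "0 \<le> y"
  shows "\<exists>x. 0 \<le> x \<and> c x = y"
proof -
  obtain i j :: 'n where ij: "i \<noteq> j"
    using two_indices by blast
  obtain X where X: "X \<in> nonneg_GL" "\<Phi> X = elem_matrix i j y"
    using \<Phi>_surj[OF elem_matrix_in_nonneg_GL[OF ij assms]] by blast
  then have "entrywise c X = elem_matrix i j y"
    using \<Phi>_root[of X] \<Phi>_root_iff[OF X(1)] elem_matrix_root[OF ij assms] by simp
  then have "c (X $ i $ j) = y"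
    using ij by (simp add: vec_eq_iff entrywise_def elem_matrix_eq mat_def single_entry_def)
  moreover have "0 \<le> X $ i $ j"
    using X(1) nonneg_GL_nonneg nonneg_matD by blast
  ultimately show ?thesis
    by blast
qed

lemma c_nonneg_aut: "nonneg_aut c"
proof -
  have "bij_betw c nonneg_part nonneg_part"
  proof (rule bij_betwI')
    show "c x = c y \<longleftrightarrow> x = y" if "x \<in> nonneg_part" "y \<in> nonneg_part" for x y
      using c_inject[of x y] that by (auto simp: nonneg_part_def)
    show "c x \<in> nonneg_part" if "x \<in> nonneg_part" for x
      using c_nonneg that by (simp add: nonneg_part_def)
    show "\<exists>x\<in>nonneg_part. y = c x" if "y \<in> nonneg_part" for y
      using c_surj[of y] that by (auto simp: nonneg_part_def)
  qed
  then show ?thesis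
    by (simp add: nonneg_aut_def nonneg_part_def c_add c_mult)
qed

section \<open>Standard form up to scalars\<close>

text \<open>
  The scalar stands inside the entrywise map because the homothety is applied first. The property is
  stated for single matrices instead of composing \<open>\<Phi>\<close> with the inverse of the entrywise map: \<open>c\<close> acts on
  \<open>R\<^sub>+\<close> only, and applying it to the entries of a matrix whose inverse has entries outside \<open>R\<^sub>+\<close>
  need not give an invertible matrix.
\<close>

definition standard_up_to_scalar :: "'a ^ 'n ^ 'n \<Rightarrow> bool" where
  "standard_up_to_scalar X \<longleftrightarrow>
     X \<in> nonneg_GL \<and> (\<exists>u. pos_unit u \<and> \<Phi> X = entrywise c (mat u ** X))"

lemma pos_unit_mult: "pos_unit u \<Longrightarrow> pos_unit v \<Longrightarrow> pos_unit (u * (v::'a))"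
  unfolding pos_unit_def by (metis mult.assoc mult.left_commute mult_1_right mult_nonneg_nonneg)

lemma nonneg_scalar: "0 \<le> u \<Longrightarrow> nonneg_mat (mat u :: 'a ^ 'n ^ 'n)"
  by (simp add: nonneg_mat_def mat_def)

lemma scalar_mult_mult: "mat u ** X ** (mat v ** Y) = mat (u * v) ** (X ** (Y :: 'a ^ 'n ^ 'n))"
proof -
  have "mat u ** X ** (mat v ** Y) = mat u ** (X ** mat v) ** Y"
    by (simp only: matrix_mul_assoc)
  also have "X ** mat v = mat v ** X"
    by (rule scalar_commute[symmetric])
  finally show ?thesis
    by (simp only: matrix_mul_assoc scalar_mult_scalar)
qed

lemma standard_mult:
  assumes "X \<in> nonneg_GL" "Y \<in> nonneg_GL" "0 \<le> u" "0 \<le> v"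
    and "\<Phi> X = entrywise c (mat u ** X)" "\<Phi> Y = entrywise c (mat v ** Y)"
  shows "\<Phi> (X ** Y) = entrywise c (mat (u * v) ** (X ** Y))"
  using assms by (simp add: \<Phi>_mult scalar_mult_mult[symmetric] entrywise_mult nonneg_mat_mult
      nonneg_GL_nonneg nonneg_scalar)

lemma standard_up_to_scalar_mult:
  assumes "standard_up_to_scalar X" "standard_up_to_scalar Y"
  shows "standard_up_to_scalar (X ** Y)"
proof -
  obtain u v where X: "X \<in> nonneg_GL" "pos_unit u" "\<Phi> X = entrywise c (mat u ** X)"
    and Y: "Y \<in> nonneg_GL" "pos_unit v" "\<Phi> Y = entrywise c (mat v ** Y)"
    using assms by (auto simp: standard_up_to_scalar_def)
  then have "\<Phi> (X ** Y) = entrywise c (mat (u * v) ** (X ** Y))"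
    by (intro standard_mult) (auto simp: pos_unit_def)
  then show ?thesis
    unfolding standard_up_to_scalar_def
    using nonneg_GL_mult[OF X(1) Y(1)] pos_unit_mult[OF X(2) Y(2)] by blast
qed

lemma standard_up_to_scalarI:
  assumes X: "X \<in> nonneg_GL" and v: "pos_unit v" and eq: "\<Phi> X = mat v ** entrywise c X"
  shows "standard_up_to_scalar X"
proof -
  obtain w where w: "0 \<le> v" "0 \<le> w" "v * w = 1"
    using v by (auto simp: pos_unit_def)
  obtain u t where ut: "0 \<le> u" "c u = v" "0 \<le> t" "c t = w"
    using c_surj w by metis
  have "c (u * t) = c 1"
    using ut w by (simp add: c_mult c_1)
  then have "u * t = 1"
    using ut zero_le_1 c_inject[of "u * t" 1] by simp
  then have "pos_unit u"
    using ut by (auto simp: pos_unit_def)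
  moreover have "\<Phi> X = entrywise c (mat u ** X)"
    using eq ut X by (simp add: entrywise_mult entrywise_scalar nonneg_scalar nonneg_GL_nonneg)
  ultimately show ?thesis
    using X by (auto simp: standard_up_to_scalar_def)
qed

lemma standard_up_to_scalarE:
  assumes "standard_up_to_scalar X"
  obtains w where "pos_unit w" "entrywise c X = mat w ** \<Phi> X"
proof -
  obtain u where u: "X \<in> nonneg_GL" "pos_unit u" "\<Phi> X = entrywise c (mat u ** X)"
    using assms by (auto simp: standard_up_to_scalar_def)
  obtain t where t: "0 \<le> u" "0 \<le> t" "u * t = 1"
    using u by (auto simp: pos_unit_def)
  have ct: "c t * c u = 1"
    using t c_mult[of u t] c_1 by (simp add: mult.commute)
  have "pos_unit (c t)"
    using ct c_nonneg[OF t(1)] c_nonneg[OF t(2)] by (auto simp: pos_unit_def)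
  moreover have "entrywise c X = mat (c t) ** \<Phi> X"
    using u(1) t by (simp add: u(3) entrywise_mult entrywise_scalar nonneg_scalar nonneg_GL_nonneg
        matrix_mul_assoc scalar_mult_scalar ct)
  ultimately show ?thesis
    by (rule that)
qed

text \<open>
  Conjugation by a unit \<open>g\<close> permutes the root elements, on which \<open>\<Phi>\<close> is known. So \<open>\<Phi>(g)\<close> and
  \<open>g\<^sup>c\<close> conjugate the elementary matrices in the same way and differ by a scalar.
\<close>

lemma standard_units:
  assumes g: "g \<in> nonneg_GL_units"
  shows "standard_up_to_scalar g"
proof -
  note assoc = matrix_mul_assoc
  obtain g' where g': "nonneg_mat g" "nonneg_mat g'" "g ** g' = mat 1" "g' ** g = mat 1"
    using g by (auto simp: units_iff)
  have in_GL: "g \<in> nonneg_GL" "g' \<in> nonneg_GL"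
    using g' by (auto simp: nonneg_GL_iff invertible_def)
  interpret conj: nonneg_GL_automorphism ring_type "\<lambda>X. g ** X ** g'"
    by unfold_locales (use unit_conj_aut[OF g'] card3 in auto)
  let ?c = "entrywise c"
  have c1: "?c g ** ?c g' = mat 1" "?c g' ** ?c g = mat 1"
    using g' by (simp_all add: entrywise_mult[symmetric] entrywise_scalar c_1)
  have \<Phi>1: "\<Phi> g' ** \<Phi> g = mat 1" "\<Phi> g ** \<Phi> g' = mat 1"
    using g' in_GL by (simp_all add: \<Phi>_mult_eq_1)
  define Z where "Z = ?c g' ** \<Phi> g"
  have "Z ** single_entry i j 1 = single_entry i j 1 ** Z" if ij: "i \<noteq> j" for i j
  proof -
    let ?B = "elem_matrix i j 1 :: 'a ^ 'n ^ 'n"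
    have "g ** ?B ** g' \<in> root_elements"
      using conj.\<Phi>_root_iff elem_matrix_in_nonneg_GL elem_matrix_root ij zero_le_1 by blast
    then have "\<Phi> (g ** ?B ** g') = ?c (g ** ?B ** g')"
      by (rule \<Phi>_root)
    then have eq: "\<Phi> g ** ?B ** \<Phi> g' = ?c g ** ?B ** ?c g'"
      using in_GL ij zero_le_1
      by (simp add: \<Phi>_mult elem_matrix_in_nonneg_GL nonneg_GL_mult fixes_elem entrywise_mult nonneg_mat_mult
          nonneg_GL_nonneg entrywise_elem c_1)
    have "Z ** ?B = ?c g' ** (\<Phi> g ** ?B ** \<Phi> g') ** \<Phi> g"
      unfolding Z_def by (simp add: assoc[symmetric] \<Phi>1)
    also have "\<dots> = (?c g' ** ?c g) ** ?B ** ?c g' ** \<Phi> g"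
      by (simp add: eq assoc)
    also have "\<dots> = ?B ** Z"
      by (simp add: c1 Z_def assoc)
    finally show ?thesis
      by (simp add: elem_matrix_eq mat_distribs)
  qed
  then obtain z where z: "Z = mat z"
    using scalar_if_commutes_single_entries[of Z] card3 by auto
  define W where "W = \<Phi> g' ** ?c g"
  have ZW: "Z ** W = mat 1"
    unfolding Z_def W_def by (rule inverse_mult) (simp_all add: c1 \<Phi>1)
  have nonneg: "nonneg_mat Z" "nonneg_mat W"
    unfolding Z_def W_def
    by (simp_all add: nonneg_mat_mult entrywise_nonneg g' nonneg_GL_nonneg \<Phi>_in in_GL)
  obtain i :: 'n where True by blast
  have "z * W $ i $ i = 1"
    using arg_cong[OF ZW, of "\<lambda>X. X $ i $ i"] by (simp add: z scalar_component) (simp add: mat_def)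
  moreover have "z = Z $ i $ i"
    by (simp add: z mat_def)
  ultimately have "pos_unit z"
    using nonneg_matD[OF nonneg(1), of i i] nonneg_matD[OF nonneg(2), of i i]
    by (auto simp: pos_unit_def)
  moreover have "\<Phi> g = mat z ** ?c g"
    unfolding scalar_commute unfolding z[symmetric] Z_def by (simp add: assoc c1)
  ultimately show ?thesis
    using in_GL(1) by (intro standard_up_to_scalarI)
qed

lemma perm_matrix_units:
  assumes "\<sigma> permutes (UNIV :: 'n set)"
  shows "perm_matrix \<sigma> \<in> (nonneg_GL_units :: ('a ^ 'n ^ 'n) set)"
proof -
  have mult: "perm_matrix \<tau> ** perm_matrix \<rho> = (perm_matrix (\<tau> \<circ> \<rho>) :: 'a ^ 'n ^ 'n)"
    for \<tau> \<rho> :: "'n \<Rightarrow> 'n"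
    by (simp add: vec_eq_iff perm_matrix_def mult_component if_distrib[of "\<lambda>x. _ * x"] cong: if_cong)
  have one: "perm_matrix id = (mat 1 :: 'a ^ 'n ^ 'n)"
    by (simp add: perm_matrix_def mat_def)
  have nonneg: "nonneg_mat (perm_matrix \<tau> :: 'a ^ 'n ^ 'n)" for \<tau> :: "'n \<Rightarrow> 'n"
    using zero_le_1 by (simp add: nonneg_mat_def perm_matrix_def)
  have "perm_matrix \<sigma> ** perm_matrix (inv \<sigma>) = (mat 1 :: 'a ^ 'n ^ 'n)"
      "perm_matrix (inv \<sigma>) ** perm_matrix \<sigma> = (mat 1 :: 'a ^ 'n ^ 'n)"
    unfolding mult permutes_inv_o[OF assms] by (rule one)+
  then show ?thesis
    using nonneg units_iff by blast
qed

lemma standard_P: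
  assumes "X \<in> P_semigroup"
  shows "standard_up_to_scalar X"
  using assms unfolding P_semigroup_def
proof (induction rule: semigroup_generated.induct)
  case (base A)
  then consider \<sigma> where "\<sigma> permutes UNIV" "A = perm_matrix \<sigma>"
    | i j x where "i \<noteq> j" "0 \<le> x" "A = elem_matrix i j x" | "A \<in> diag_units"
    by (auto simp: nonneg_part_def)
  then show ?case
  proof cases
    case 1
    then show ?thesis
      by (simp add: standard_units perm_matrix_units)
  next
    case 2
    then show ?thesis
      by (intro standard_up_to_scalarI[of _ 1])
        (simp_all add: elem_matrix_in_nonneg_GL pos_unit_1 \<Phi>_elem_c entrywise_elem)
  next
    case 3
    then show ?thesis
      by (simp add: standard_units diag_units_def)
  qed
next
  case (mult A B)
  then show ?case
    by (simp add: standard_up_to_scalar_mult)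
qed

text \<open>
  The step that carries the standard form along a \<open>\<P>\<close>-equivalence. Both \<open>\<Phi>(PAP')\<close> and its entrywise
  counterpart factor through \<open>\<Phi>(P)\<close> and \<open>\<Phi>(P')\<close>, which are invertible over \<open>R\<close>.
\<close>

lemma standard_cancel:
  assumes std: "standard_up_to_scalar P" "standard_up_to_scalar P'" "standard_up_to_scalar (P ** A ** P')"
    and A: "A \<in> nonneg_GL"
  shows "standard_up_to_scalar A"
proof -
  let ?c = "entrywise c"
  have in_GL: "P \<in> nonneg_GL" "P' \<in> nonneg_GL"
    using std by (simp_all add: standard_up_to_scalar_def)
  obtain w where w: "pos_unit w" "?c P = mat w ** \<Phi> P"
    using std(1) by (rule standard_up_to_scalarE)
  obtain w' where w': "pos_unit w'" "?c P' = mat w' ** \<Phi> P'"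
    using std(2) by (rule standard_up_to_scalarE)
  obtain v where v: "pos_unit v" "?c (P ** A ** P') = mat v ** \<Phi> (P ** A ** P')"
    using std(3) by (rule standard_up_to_scalarE)
  obtain t where t: "0 \<le> v" "0 \<le> t" "v * t = 1"
    using v(1) by (auto simp: pos_unit_def)
  have "?c (P ** A ** P') = mat w ** \<Phi> P ** (mat 1 ** ?c A) ** (mat w' ** \<Phi> P')"
    using in_GL A by (simp add: entrywise_mult nonneg_mat_mult nonneg_GL_nonneg w w')
  also have "\<dots> = mat (w * w') ** (\<Phi> P ** ?c A ** \<Phi> P')"
    by (simp only: scalar_mult_mult mult_1_right)
  finally have "mat (w * w') ** (\<Phi> P ** ?c A ** \<Phi> P') = mat v ** (\<Phi> P ** \<Phi> A ** \<Phi> P')"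
    using v(2) in_GL A by (simp add: \<Phi>_mult nonneg_GL_mult)
  then have eq: "\<Phi> P ** (mat (w * w') ** ?c A) ** \<Phi> P' = \<Phi> P ** (mat v ** \<Phi> A) ** \<Phi> P'"
    by (simp only: matrix_mul_assoc scalar_commute[of _ "\<Phi> P"])
  obtain Q where Q: "Q ** \<Phi> P = mat 1"
    using \<Phi>_in[OF in_GL(1)] by (auto simp: nonneg_GL_iff invertible_def)
  obtain Q' where Q': "\<Phi> P' ** Q' = mat 1"
    using \<Phi>_in[OF in_GL(2)] by (auto simp: nonneg_GL_iff invertible_def)
  have "mat (w * w') ** ?c A = mat v ** \<Phi> A"
    by (rule mat_cancel_left[OF Q mat_cancel_right[OF Q' eq]])
  then have "mat t ** (mat (w * w') ** ?c A) = mat t ** (mat v ** \<Phi> A)"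
    by simp
  then have "\<Phi> A = mat (t * (w * w')) ** ?c A"
    using t(3) by (simp add: matrix_mul_assoc scalar_mult_scalar mult.commute[of t v])
  moreover have "pos_unit (t * (w * w'))"
    using t w(1) w'(1) by (intro pos_unit_mult) (auto simp: pos_unit_def mult.commute)
  ultimately show ?thesis
    using A by (intro standard_up_to_scalarI)
qed

lemma standard_P_equivalent:
  assumes "P_equivalent A B" "standard_up_to_scalar B"
  shows "standard_up_to_scalar A"
proof -
  obtain k C P P' Q Q' where C: "C 0 = A" "C k = B" "\<And>i. i \<le> k \<Longrightarrow> C i \<in> nonneg_GL"
    and P: "\<And>i. i < k \<Longrightarrow> P i \<in> P_semigroup \<and> P' i \<in> P_semigroup \<and> Q i \<in> P_semigroup \<and>
        Q' i \<in> P_semigroup \<and> P i ** C i ** P' i = Q i ** C (Suc i) ** Q' i"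
    using assms(1) unfolding P_equivalent_def by metis
  have "standard_up_to_scalar (C 0)"
  proof (rule inc_induct[of 0 k])
    show "standard_up_to_scalar (C k)"
      using C(2) assms(2) by simp
  next
    fix i assume i: "i < k" and IH: "standard_up_to_scalar (C (Suc i))"
    have std: "standard_up_to_scalar (P i ** C i ** P' i)"
      using P[OF i] IH by (simp add: standard_up_to_scalar_mult standard_P)
    show "standard_up_to_scalar (C i)"
      by (rule standard_cancel[OF standard_P standard_P std C(3)]) (use P[OF i] i in simp_all)
  qed simp
  then show ?thesis
    by (simp add: C)
qed

lemma standard_GE_plus:
  assumes "X \<in> GE_plus"
  shows "standard_up_to_scalar X"
  using assms unfolding GE_plus_def
  by (induction rule: semigroup_generated.induct)
    (auto intro: standard_P_equivalent standard_P standard_up_to_scalar_mult)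

lemma scalar_in_GE_plus:
  assumes "pos_unit u"
  shows "mat u \<in> (GE_plus :: ('a ^ 'n ^ 'n) set)"
proof -
  have d: "mat u \<in> (diag_units :: ('a ^ 'n ^ 'n) set)"
    using assms unfolding diag_units_iff mat_eq_diag by blast
  then have P: "mat u \<in> (P_semigroup :: ('a ^ 'n ^ 'n) set)"
    unfolding P_semigroup_def by (intro semigroup_generated.base) simp
  have "P_equivalent (mat u) (mat u :: 'a ^ 'n ^ 'n)"
    unfolding P_equivalent_def
    by (intro exI[of _ 0] exI[of _ "\<lambda>_. mat u"]) (simp add: diag_in_nonneg_GL d)
  then show ?thesis
    unfolding GE_plus_def using P d diag_in_nonneg_GL
    by (intro semigroup_generated.base) blast
qed

text \<open>
  The scalar of a matrix is unique, since \<open>c\<close> is injective and the matrix invertible; hence it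
  depends multiplicatively on the matrix.
\<close>

lemma standard_on_GE_plus:
  "\<exists>\<Omega>. central_homothety GE_plus \<Omega> \<and> (\<forall>X\<in>GE_plus. \<Phi> X = entrywise c (\<Omega> X))"
proof -
  define u where "u X = (SOME u. pos_unit u \<and> \<Phi> X = entrywise c (mat u ** X))" for X
  have u: "pos_unit (u X)" "\<Phi> X = entrywise c (mat (u X) ** X)" and GL: "X \<in> nonneg_GL"
    if "X \<in> GE_plus" for X
  proof -
    have std: "X \<in> nonneg_GL \<and> (\<exists>u. pos_unit u \<and> \<Phi> X = entrywise c (mat u ** X))"
      using standard_GE_plus[OF that] by (simp add: standard_up_to_scalar_def)
    then show "X \<in> nonneg_GL"
      by simp
    show "pos_unit (u X)" "\<Phi> X = entrywise c (mat (u X) ** X)"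
      using someI_ex[OF std[THEN conjunct2]] unfolding u_def by blast+
  qed
  define l where "l X = (mat (u X) :: 'a ^ 'n ^ 'n)" for X
  have l_mult: "l (X ** Y) = l X ** l Y" if XY: "X \<in> GE_plus" "Y \<in> GE_plus" for X Y
  proof -
    have XY_in: "X ** Y \<in> GE_plus"
      using XY unfolding GE_plus_def by (rule semigroup_generated.mult)
    have nn: "0 \<le> u X" "0 \<le> u Y" "0 \<le> u (X ** Y)"
      using u(1) XY XY_in by (auto simp: pos_unit_def)
    have "entrywise c (mat (u (X ** Y)) ** (X ** Y)) = entrywise c (mat (u X * u Y) ** (X ** Y))"
      using standard_mult[OF GL[OF XY(1)] GL[OF XY(2)] nn(1,2) u(2)[OF XY(1)] u(2)[OF XY(2)]]
        u(2)[OF XY_in] by simp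
    then have eq: "mat (u (X ** Y)) ** (X ** Y) = mat (u X * u Y) ** (X ** Y)"
      by (rule entrywise_inject[rotated 2])
        (simp_all add: nonneg_mat_mult nonneg_scalar nonneg_GL_nonneg nn GL XY)
    obtain Z where Z: "(X ** Y) ** Z = mat 1"
      using GL[OF XY_in] by (auto simp: nonneg_GL_iff invertible_def)
    show ?thesis
      using mat_cancel_right[OF Z eq] by (simp add: l_def scalar_mult_scalar)
  qed
  have l_center: "l X \<in> semigroup_center GE_plus" if "X \<in> GE_plus" for X
    using scalar_in_GE_plus[OF u(1)[OF that]] scalar_commute
    by (auto simp: semigroup_center_def l_def)
  have "l X \<in> GE_plus" if "X \<in> GE_plus" for X
    using l_center[OF that] by (simp add: semigroup_center_def)
  then have "central_hom GE_plus l"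
    by (simp add: central_hom_def semigroup_hom_def image_subset_iff l_mult l_center)
  then have "central_homothety GE_plus (\<lambda>X. l X ** X)"
    unfolding central_homothety_def by blast
  moreover have "\<forall>X\<in>GE_plus. \<Phi> X = entrywise c (l X ** X)"
    using u(2) by (simp add: l_def)
  ultimately show ?thesis
    by blast
qed

end

section \<open>The structure theorem\<close>

theorem theorem1:
  fixes q :: "rat \<Rightarrow> 'a::{comm_ring_1, ordered_comm_ring}"
    and \<Phi> :: "'a ^ 'n ^ 'n \<Rightarrow> 'a ^ 'n ^ 'n"
  assumes "rat_embedding q"
    and "\<And>m::nat. m > 0 \<Longrightarrow> 0 \<le> q (1 / of_nat m)"
    and "CARD('n) \<ge> 3"
    and "semigroup_aut nonneg_GL \<Phi>"
  shows "\<exists>M c \<Omega>. M \<in> nonneg_GL_units \<and> nonneg_aut c \<and> central_homothety GE_plus \<Omega> \<and>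
           (\<forall>X\<in>GE_plus. \<Phi> X = conj_map M (entrywise c (\<Omega> X)))"
proof -
  have q: "q 1 = 1" "q (x + y) = q x + q y" "q (x * y) = q x * q y" for x y
    using assms(1) by (simp_all add: rat_embedding_def)
  have q_0: "q 0 = 0"
    using q(2)[of 0 0] by simp
  have q_of_nat: "q (of_nat m) = of_nat m" for m
    by (induction m) (simp_all add: q q_0)
  have "\<exists>r::'a. 0 \<le> r \<and> of_nat m * r = 1" if "0 < m" for m
  proof (intro exI conjI)
    show "0 \<le> q (1 / of_nat m)"
      by (rule assms(2)[OF that])
    show "of_nat m * q (1 / of_nat m) = 1"
      using that q(3)[of "of_nat m" "1 / of_nat m"] by (simp add: q_of_nat q(1))
  qed
  then interpret nonneg_GL_automorphism "TYPE('a)" \<Phi>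
    using assms(3,4) by unfold_locales auto
  \<comment> \<open>Conjugation by \<open>M\<inverse>\<close> moves the matrix units in the image of \<open>\<Phi>\<close> to the standard ones.\<close>
  obtain M M' where M: "nonneg_mat M" "nonneg_mat M'" "M ** M' = mat 1" "M' ** M = mat 1"
    and conj: "\<And>k l. M' ** E k l ** M = single_entry k l 1"
    using conjugating_matrix by blast
  define \<Psi> where "\<Psi> X = M' ** \<Phi> X ** M" for X
  have "\<Psi> = (\<lambda>X. M' ** X ** M) \<circ> \<Phi>"
    by (auto simp: \<Psi>_def)
  moreover have conj_aut: "semigroup_aut nonneg_GL (\<lambda>X. M' ** X ** M)"
    by (rule unit_conj_aut[OF M(2,1,4,3)])
  ultimately have "semigroup_aut nonneg_GL \<Psi>"
    using assms(4) bij_betw_trans[of \<Phi> nonneg_GL nonneg_GL "\<lambda>X. M' ** X ** M" nonneg_GL]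
    unfolding semigroup_aut_def semigroup_hom_def by (auto simp: image_subset_iff)
  moreover have "\<Psi> (elem_matrix i j 1) = elem_matrix i j 1" if "i \<noteq> j" for i j
    using conj[of i j] that by (simp add: \<Psi>_def \<Phi>_elem E_offdiag mat_distribs M) (simp add: elem_matrix_eq)
  ultimately interpret normalized: normalized_automorphism "TYPE('a)" \<Psi>
    using assms(3) by unfold_locales auto
  obtain \<Omega> where \<Omega>: "central_homothety GE_plus \<Omega>"
      "\<And>X. X \<in> GE_plus \<Longrightarrow> \<Psi> X = entrywise normalized.c (\<Omega> X)"
    using normalized.standard_on_GE_plus by blast
  have "\<Phi> X = conj_map M (entrywise normalized.c (\<Omega> X))" if "X \<in> GE_plus" for X
  proof -
    have "M ** \<Psi> X ** M' = (M ** M') ** \<Phi> X ** (M ** M')"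
      unfolding \<Psi>_def by (simp only: matrix_mul_assoc)
    then show ?thesis
      using \<Omega>(2)[OF that] by (simp add: conj_map_def matrix_inv_eqI[OF M(3,4)] M(3))
  qed
  moreover have "M \<in> nonneg_GL_units"
    using M by (auto simp: units_iff)
  ultimately show ?thesis
    using \<Omega>(1) normalized.c_nonneg_aut by blast
qed

end
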